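(* Let $n\ge 1$. Suppose $\varphi$ is a linear fractional self-map of $\mathbb{B}_n$ and $\sigma$ is its adjoint map. Let $\gamma>0$ and put $f=K^{\gamma}_{\sigma(0)}$. Then the operator $W_{f,\varphi}$ is normal on $H_{\gamma}$ if and only if $|\varphi(0)|=|\sigma(0)|$ and $\varphi\circ\sigma=\sigma\circ\varphi$.
   Context: $\mathbb{B}_n$ is the open unit ball of $\mathbb{C}^n$, with $\langle z,w\rangle=\sum_j z_j\overline{w_j}$. For $\gamma>0$, $H_{\gamma}$ is the Hilbert space of analytic functions on $\mathbb{B}_n$ with reproducing kernel $K^{\gamma}_z(w)=(1-\langle w,z\rangle)^{-\gamma}$ (principal branch). For $f$ analytic on $\mathbb{B}_n$ and $\varphi$ an analytic self-map of $\mathbb{B}_n$, $W_{f,\varphi}h=f\cdot(h\circ\varphi)$ (under the hypotheses of the claim it is a bounded operator on $H_\gamma$). A linear fractional self-map of $\mathbb{B}_n$ is an analytic map $\varphi:\mathbb{B}_n\to\mathbb{B}_n$ of the form $\varphi(z)=\frac{Az+B}{\langle z,C\rangle+d}$ with $A$ a linear operator on $\mathbb{C}^n$, $B,C\in\mathbb{C}^n$ and $d\in\mathbb{C}$, where $|C|<|d|$ (this is automatic unless $\varphi$ is constant). Its adjoint map, formed from this representation, is $\sigma(z)=\frac{A^{*}z-C}{-\langle z,B\rangle+\overline{d}}$; it is known that $\sigma$ is again a self-map of $\mathbb{B}_n$. *)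

theory Defs
  imports "HOL-Analysis.Analysis"
begin

definition herm :: "complex^'n \<Rightarrow> complex^'n \<Rightarrow> complex" where
  "herm z w = (\<Sum>j\<in>UNIV. z $ j * cnj (w $ j))"

definition adjoint_mat :: "complex^'n^'n \<Rightarrow> complex^'n^'n" where
  "adjoint_mat A = (\<chi> i j. cnj (A $ j $ i))"

(* Complex differentiability in several variables: the Frechet derivative
   (over the reals) is complex linear. *)
definition analytic_Cn :: "(complex^'n \<Rightarrow> complex) \<Rightarrow> (complex^'n) set \<Rightarrow> bool" where
  "analytic_Cn f S \<longleftrightarrow>
     (\<forall>z\<in>S. \<exists>a :: complex^'n. (f has_derivative (\<lambda>h. \<Sum>j\<in>UNIV. a $ j * h $ j)) (at z))"

definition ip_norm :: "(('a \<Rightarrow> complex) \<Rightarrow> ('a \<Rightarrow> complex) \<Rightarrow> complex) \<Rightarrow> ('a \<Rightarrow> complex) \<Rightarrow> real" where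
  "ip_norm ip h = sqrt (Re (ip h h))"

(* A complex Hilbert space whose vectors are the functions in the carrier H,
   with inner product ip, linear in the first argument. *)
locale function_hilbert_space =
  fixes H :: "('a \<Rightarrow> complex) set"
    and ip :: "('a \<Rightarrow> complex) \<Rightarrow> ('a \<Rightarrow> complex) \<Rightarrow> complex"
  assumes zero_mem: "(\<lambda>x. 0) \<in> H"
    and add_mem: "\<lbrakk>g \<in> H; h \<in> H\<rbrakk> \<Longrightarrow> (\<lambda>x. g x + h x) \<in> H"
    and scale_mem: "h \<in> H \<Longrightarrow> (\<lambda>x. c * h x) \<in> H"
    and ip_add: "\<lbrakk>g \<in> H; h \<in> H; k \<in> H\<rbrakk> \<Longrightarrow> ip (\<lambda>x. g x + h x) k = ip g k + ip h k"
    and ip_scale: "\<lbrakk>h \<in> H; k \<in> H\<rbrakk> \<Longrightarrow> ip (\<lambda>x. c * h x) k = c * ip h k"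
    and ip_sym: "\<lbrakk>h \<in> H; k \<in> H\<rbrakk> \<Longrightarrow> ip k h = cnj (ip h k)"
    and ip_nonneg: "h \<in> H \<Longrightarrow> 0 \<le> Re (ip h h)"
    and ip_definite: "\<lbrakk>h \<in> H; ip h h = 0\<rbrakk> \<Longrightarrow> h = (\<lambda>x. 0)"
    and complete:
      "\<lbrakk>\<And>m::nat. X m \<in> H;
        \<forall>e>0. \<exists>N. \<forall>k\<ge>N. \<forall>m\<ge>N. ip_norm ip (\<lambda>x. X k x - X m x) < e\<rbrakk>
       \<Longrightarrow> \<exists>h\<in>H. (\<lambda>m. ip_norm ip (\<lambda>x. X m x - h x)) \<longlonglongrightarrow> 0"

(* Functions on the unit ball are represented by total functions that vanish
   outside it, so that equality of functions is equality on the ball. *)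
definition ball_kernel :: "real \<Rightarrow> complex^'n \<Rightarrow> complex^'n \<Rightarrow> complex" where
  "ball_kernel \<gamma> z = (\<lambda>w. if w \<in> ball 0 1 then (1 - herm w z) powr (- of_real \<gamma>) else 0)"

(* A function space is determined, inner product included, by its reproducing
   kernel, so at most one pair (H, ip) satisfies this for a given \<gamma>; for \<gamma> > 0 the
   kernel is positive definite and the pair exists. *)
locale ball_space = function_hilbert_space H ip
  for H :: "(complex^'n \<Rightarrow> complex) set"
    and ip :: "(complex^'n \<Rightarrow> complex) \<Rightarrow> (complex^'n \<Rightarrow> complex) \<Rightarrow> complex" +
  fixes \<gamma> :: real
  assumes analytic: "h \<in> H \<Longrightarrow> analytic_Cn h (ball 0 1)"
    and vanish_outside: "\<lbrakk>h \<in> H; z \<notin> ball 0 1\<rbrakk> \<Longrightarrow> h z = 0"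
    and kernel_mem: "z \<in> ball 0 1 \<Longrightarrow> ball_kernel \<gamma> z \<in> H"
    and reproducing: "\<lbrakk>z \<in> ball 0 1; h \<in> H\<rbrakk> \<Longrightarrow> h z = ip h (ball_kernel \<gamma> z)"

definition bounded_operator_on ::
  "('a \<Rightarrow> complex) set \<Rightarrow> (('a \<Rightarrow> complex) \<Rightarrow> ('a \<Rightarrow> complex) \<Rightarrow> complex) \<Rightarrow>
   (('a \<Rightarrow> complex) \<Rightarrow> ('a \<Rightarrow> complex)) \<Rightarrow> bool" where
  "bounded_operator_on H ip T \<longleftrightarrow>
     (\<forall>h\<in>H. T h \<in> H) \<and>
     (\<forall>g\<in>H. \<forall>h\<in>H. T (\<lambda>x. g x + h x) = (\<lambda>x. T g x + T h x)) \<and>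
     (\<forall>c. \<forall>h\<in>H. T (\<lambda>x. c * h x) = (\<lambda>x. c * T h x)) \<and>
     (\<exists>M. \<forall>h\<in>H. ip_norm ip (T h) \<le> M * ip_norm ip h)"

definition normal_operator_on ::
  "('a \<Rightarrow> complex) set \<Rightarrow> (('a \<Rightarrow> complex) \<Rightarrow> ('a \<Rightarrow> complex) \<Rightarrow> complex) \<Rightarrow>
   (('a \<Rightarrow> complex) \<Rightarrow> ('a \<Rightarrow> complex)) \<Rightarrow> bool" where
  "normal_operator_on H ip T \<longleftrightarrow>
     bounded_operator_on H ip T \<and>
     (\<exists>S. bounded_operator_on H ip S \<and>
          (\<forall>g\<in>H. \<forall>h\<in>H. ip (T g) h = ip g (S h)) \<and>
          (\<forall>h\<in>H. T (S h) = S (T h)))"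

definition weighted_comp ::
  "(complex^'n \<Rightarrow> complex) \<Rightarrow> (complex^'n \<Rightarrow> complex^'n) \<Rightarrow>
   (complex^'n \<Rightarrow> complex) \<Rightarrow> (complex^'n \<Rightarrow> complex)" where
  "weighted_comp f \<phi> h = (\<lambda>z. if z \<in> ball 0 1 then f z * h (\<phi> z) else 0)"

definition lin_frac ::
  "complex^'n^'n \<Rightarrow> complex^'n \<Rightarrow> complex^'n \<Rightarrow> complex \<Rightarrow> complex^'n \<Rightarrow> complex^'n" where
  "lin_frac A B C d z = inverse (herm z C + d) *s (A *v z + B)"

(* Since |C| < |d|, the denominator has no zero in the closed ball, so the map is
   automatically analytic. *)
definition lin_frac_self_map ::
  "complex^'n^'n \<Rightarrow> complex^'n \<Rightarrow> complex^'n \<Rightarrow> complex \<Rightarrow> bool" where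
  "lin_frac_self_map A B C d \<longleftrightarrow>
     norm C < cmod d \<and> lin_frac A B C d ` ball 0 1 \<subseteq> ball 0 1"

definition adjoint_map ::
  "complex^'n^'n \<Rightarrow> complex^'n \<Rightarrow> complex^'n \<Rightarrow> complex \<Rightarrow> complex^'n \<Rightarrow> complex^'n" where
  "adjoint_map A B C d z = inverse (- herm z B + cnj d) *s (adjoint_mat A *v z - C)"

end

theory Submission
  imports Defs
begin

text \<open>
  With \<open>K\<close> the kernel, the linear fractional map and its adjoint satisfy
  \<open>(1 - \<langle>\<phi> z, w\<rangle>) (1 - \<langle>z, \<sigma> 0\<rangle>) = (1 - \<langle>\<phi> 0, w\<rangle>) (1 - \<langle>z, \<sigma> w\<rangle>)\<close>. All four factors lie in the right
  half plane, so the identity survives powers, and \<open>W\<close> maps \<open>K w\<close> to a multiple of \<open>K (\<sigma> w)\<close>, while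
  its adjoint, the weighted composition operator with the roles of \<open>\<phi>\<close> and \<open>\<sigma>\<close> exchanged, maps it to
  a multiple of \<open>K (\<phi> w)\<close>. Comparing both products on kernels gives the equivalence. Boundedness of \<open>W\<close>
  is obtained on multiples of kernels from a Schwarz--Pick estimate, and passes to their span with
  the same constant because \<open>W\<close> and its adjoint leave the set of these multiples invariant.
\<close>

section \<open>Spans and bounded operators in function Hilbert spaces\<close>

text \<open>Linear combinations grow by one scaled generator at a time, so a property of the
  generators passes to all of them by an induction with a single new term.\<close>

inductive_set fun_span :: "('a \<Rightarrow> complex) set \<Rightarrow> ('a \<Rightarrow> complex) set" for G where
  zero: "(\<lambda>x. 0) \<in> fun_span G"
| step: "\<lbrakk>h \<in> fun_span G; g \<in> G\<rbrakk> \<Longrightarrow> (\<lambda>x. h x + c * g x) \<in> fun_span G"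

lemma fun_span_add:
  assumes "g \<in> fun_span G" "h \<in> fun_span G"
  shows "(\<lambda>x. g x + h x) \<in> fun_span G"
  using assms(2)
proof induction
  case zero
  then show ?case using assms(1) by simp
next
  case (step h k c)
  then have "(\<lambda>x. (g x + h x) + c * k x) \<in> fun_span G"
    by (intro fun_span.step)
  then show ?case by (simp add: add.assoc)
qed

lemma fun_span_scale:
  assumes "h \<in> fun_span G"
  shows "(\<lambda>x. a * h x) \<in> fun_span G"
  using assms
proof induction
  case zero
  then show ?case by (simp add: fun_span.zero)
next
  case (step h k c)
  then have "(\<lambda>x. a * h x + (a * c) * k x) \<in> fun_span G"
    by (intro fun_span.step)
  then show ?case by (simp add: algebra_simps)
qed

lemma fun_span_diff:
  assumes "g \<in> fun_span G" "h \<in> fun_span G"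
  shows "(\<lambda>x. g x - h x) \<in> fun_span G"
  using fun_span_add[OF assms(1) fun_span_scale[OF assms(2), of "-1"]] by simp

lemma fun_span_superset: "g \<in> G \<Longrightarrow> g \<in> fun_span G"
  using fun_span.step[OF fun_span.zero, of g G 1] by simp

text \<open>Linearity is required on all functions, not only on a subspace, so that iterates and
  compositions stay linear without membership side conditions.\<close>

definition fun_linear :: "(('a \<Rightarrow> complex) \<Rightarrow> ('b \<Rightarrow> complex)) \<Rightarrow> bool" where
  "fun_linear T \<longleftrightarrow> (\<forall>g h. T (\<lambda>x. g x + h x) = (\<lambda>x. T g x + T h x)) \<and>
     (\<forall>c h. T (\<lambda>x. c * h x) = (\<lambda>x. c * T h x))"

lemma fun_linear_add: "fun_linear T \<Longrightarrow> T (\<lambda>x. g x + h x) = (\<lambda>x. T g x + T h x)"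
  and fun_linear_scale: "fun_linear T \<Longrightarrow> T (\<lambda>x. c * h x) = (\<lambda>x. c * T h x)"
  by (simp_all add: fun_linear_def)

lemma fun_linear_zero: "fun_linear T \<Longrightarrow> T (\<lambda>x. 0) = (\<lambda>x. 0)"
  using fun_linear_scale[of T 0 "\<lambda>x. 0"] by simp

lemma fun_linear_diff: "fun_linear T \<Longrightarrow> T (\<lambda>x. g x - h x) = (\<lambda>x. T g x - T h x)"
  using fun_linear_add[of T g "\<lambda>x. -1 * h x"] fun_linear_scale[of T "-1" h] by simp

lemma fun_linear_funpow:
  fixes T :: "('a \<Rightarrow> complex) \<Rightarrow> 'a \<Rightarrow> complex"
  shows "fun_linear T \<Longrightarrow> fun_linear (T ^^ m)"
  by (induction m) (simp_all add: fun_linear_def)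

lemma fun_linear_compose: "\<lbrakk>fun_linear S; fun_linear T\<rbrakk> \<Longrightarrow> fun_linear (S \<circ> T)"
  by (simp add: fun_linear_def)

lemma fun_span_image:
  assumes "fun_linear T" "\<And>g. g \<in> G \<Longrightarrow> T g \<in> fun_span G'" "h \<in> fun_span G"
  shows "T h \<in> fun_span G'"
  using assms(3)
proof induction
  case (step h g c)
  then show ?case
    using fun_span_add[OF step.IH fun_span_scale[OF assms(2)[OF step(2)], of c]]
    by (simp add: fun_linear_add[OF assms(1)] fun_linear_scale[OF assms(1)])
qed (simp add: fun_linear_zero[OF assms(1)] fun_span.zero)

text \<open>Log-convexity makes the ratios \<open>a (Suc m) / a m\<close> nondecreasing. If the
  first ratio \<open>r\<close> exceeded \<open>R\<close>, then \<open>a m\<close> would be at least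
  \<open>r ^ m * a 0\<close>, which outgrows \<open>C * R ^ m\<close> whatever \<open>C\<close>
  is.\<close>

lemma log_convex_exponential_growth:
  fixes a :: "nat \<Rightarrow> real"
  assumes pos: "\<And>m. a m \<ge> 0" and conv: "\<And>m. (a (Suc m))\<^sup>2 \<le> a m * a (Suc (Suc m))"
    and growth: "\<And>m. a m \<le> C * R ^ m" and R: "R \<ge> 0"
  shows "a 1 \<le> R * a 0"
proof (rule ccontr)
  assume "\<not> ?thesis"
  then have gt: "R * a 0 < a 1" by simp
  have a0: "a 0 > 0"
  proof (rule ccontr)
    assume "\<not> a 0 > 0"
    then have "a 0 = 0" using pos[of 0] by linarith
    then show False using conv[of 0] gt by simp
  qed
  define r where "r = a 1 / a 0"
  have r: "r > R" using gt a0 by (simp add: r_def field_simps)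
  \<comment> \<open>Positivity is carried in the induction so that \<open>a m\<close> can be
    cancelled from the log-convexity inequality.\<close>
  have step: "a m > 0 \<and> a (Suc m) \<ge> r * a m" for m
  proof (induction m)
    case 0
    then show ?case using a0 by (simp add: r_def)
  next
    case (Suc m)
    have p: "a (Suc m) > 0" using Suc r R
      by (smt (verit) mult_pos_pos)
    have "(r * a m) * a (Suc m) \<le> a (Suc m) * a (Suc m)"
      using Suc p by (intro mult_right_mono) auto
    also have "\<dots> \<le> a m * a (Suc (Suc m))"
      using conv[of m] by (simp add: power2_eq_square)
    finally have "a m * (r * a (Suc m)) \<le> a m * a (Suc (Suc m))"
      by (simp add: algebra_simps)
    then show ?case using Suc p by simp
  qed
  have low: "r ^ m * a 0 \<le> a m" for m
  proof (induction m)
    case (Suc m)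
    have "r ^ Suc m * a 0 \<le> r * a m" using Suc r R by simp
    then show ?case using step[of m] by linarith
  qed simp
  have Rpos: "R > 0"
    using growth[of 1] growth[of 0] step[of 0] step[of 1] R
    by (cases "R = 0") auto
  have bd: "(r / R) ^ m \<le> C / a 0" for m
    using low[of m] growth[of m] a0 Rpos by (simp add: power_divide field_simps)
  have "1 < r / R" using r Rpos by simp
  then obtain m where "C / a 0 < (r / R) ^ m" using real_arch_pow by blast
  then show False using bd[of m] by simp
qed

section \<open>Geometry of function Hilbert spaces\<close>

context function_hilbert_space
begin

abbreviation nrm :: "('a \<Rightarrow> complex) \<Rightarrow> real" where "nrm \<equiv> ip_norm ip"

lemma diff_mem: "\<lbrakk>g \<in> H; h \<in> H\<rbrakk> \<Longrightarrow> (\<lambda>x. g x - h x) \<in> H"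
  using add_mem[OF _ scale_mem[of h "-1"]] by fastforce

lemma ip_diff: "\<lbrakk>g \<in> H; h \<in> H; k \<in> H\<rbrakk> \<Longrightarrow> ip (\<lambda>x. g x - h x) k = ip g k - ip h k"
  using ip_add[of g "\<lambda>x. -1 * h x" k] ip_scale[of h k "-1"] scale_mem[of h "-1"] by simp

lemma ip_add_right:
  "\<lbrakk>g \<in> H; h \<in> H; k \<in> H\<rbrakk> \<Longrightarrow> ip k (\<lambda>x. g x + h x) = ip k g + ip k h"
  using ip_sym[of "\<lambda>x. g x + h x" k] ip_sym[of g k] ip_sym[of h k]
  by (simp add: ip_add add_mem)

lemma ip_scale_right: "\<lbrakk>h \<in> H; k \<in> H\<rbrakk> \<Longrightarrow> ip k (\<lambda>x. c * h x) = cnj c * ip k h"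
  using ip_sym[of "\<lambda>x. c * h x" k] ip_sym[of h k]
  by (simp add: ip_scale scale_mem)

lemma ip_diff_right:
  "\<lbrakk>g \<in> H; h \<in> H; k \<in> H\<rbrakk> \<Longrightarrow> ip k (\<lambda>x. g x - h x) = ip k g - ip k h"
  using ip_sym[of "\<lambda>x. g x - h x" k] ip_sym[of g k] ip_sym[of h k]
  by (simp add: ip_diff diff_mem)

lemma ip_zero: "h \<in> H \<Longrightarrow> ip (\<lambda>x. 0) h = 0" "h \<in> H \<Longrightarrow> ip h (\<lambda>x. 0) = 0"
  using ip_scale[of h h 0] ip_scale_right[of h h 0] by simp_all

lemma ip_self: "h \<in> H \<Longrightarrow> ip h h = of_real ((nrm h)\<^sup>2)"
  using ip_sym[of h h] ip_nonneg[of h]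
  by (simp add: ip_norm_def complex_eq_iff)

lemma nrm_power2: "h \<in> H \<Longrightarrow> (nrm h)\<^sup>2 = Re (ip h h)"
  by (simp add: ip_self)

lemma nrm_nonneg: "h \<in> H \<Longrightarrow> 0 \<le> nrm h"
  by (simp add: ip_norm_def ip_nonneg)

lemma nrm_scale: "h \<in> H \<Longrightarrow> nrm (\<lambda>x. c * h x) = cmod c * nrm h"
proof -
  assume h: "h \<in> H"
  have "ip (\<lambda>x. c * h x) (\<lambda>x. c * h x) = of_real ((cmod c * nrm h)\<^sup>2)"
    using h by (simp add: scale_mem ip_scale ip_scale_right ip_self power_mult_distrib
        flip: complex_norm_square)
  then show ?thesis
    using h by (simp add: ip_norm_def[of _ "\<lambda>x. c * h x"] nrm_nonneg)
qed

lemma nrm_minus_commute: "\<lbrakk>g \<in> H; h \<in> H\<rbrakk> \<Longrightarrow> nrm (\<lambda>x. g x - h x) = nrm (\<lambda>x. h x - g x)"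
  using nrm_scale[of "\<lambda>x. h x - g x" "-1"] diff_mem[of h g] by simp

lemma nrm_diff_power2:
  assumes "g \<in> H" "h \<in> H"
  shows "(nrm (\<lambda>x. g x - h x))\<^sup>2 = (nrm g)\<^sup>2 - 2 * Re (ip g h) + (nrm h)\<^sup>2"
  using assms ip_sym[of g h]
  by (simp add: nrm_power2 diff_mem ip_diff ip_diff_right)

lemma nrm_add_power2:
  assumes "g \<in> H" "h \<in> H"
  shows "(nrm (\<lambda>x. g x + h x))\<^sup>2 = (nrm g)\<^sup>2 + 2 * Re (ip g h) + (nrm h)\<^sup>2"
  using assms ip_sym[of g h]
  by (simp add: nrm_power2 add_mem ip_add ip_add_right)

lemma cauchy_schwarz:
  assumes x: "x \<in> H" and y: "y \<in> H"
  shows "cmod (ip x y) \<le> nrm x * nrm y"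
proof (cases "ip y y = 0")
  case True
  then have "y = (\<lambda>x. 0)" using ip_definite y by blast
  then show ?thesis using x y by (simp add: ip_zero nrm_nonneg)
next
  case False
  define t where "t = ip x y / ip y y"
  define z where "z = (\<lambda>u. x u - t * y u)"
  have z: "z \<in> H" by (simp add: z_def diff_mem scale_mem x y)
  have zy: "ip z y = 0"
    unfolding z_def
    by (simp only: ip_diff[OF x scale_mem[OF y] y] ip_scale[OF y y]) (simp add: t_def False)
  have "ip z z = ip z x - cnj t * ip z y"
    using ip_diff_right[OF x scale_mem[OF y] z, of t] ip_scale_right[OF y z, of t]
    by (simp add: z_def)
  also have "\<dots> = ip x x - t * cnj (ip x y)"
    using zy ip_diff[OF x scale_mem[OF y] x, of t] ip_scale[OF y x, of t] ip_sym[OF x y]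
    by (simp add: z_def)
  also have "t * cnj (ip x y) = of_real ((cmod (ip x y))\<^sup>2 / (nrm y)\<^sup>2)"
    by (simp add: t_def ip_self[OF y] flip: complex_norm_square)
  finally have "0 \<le> (nrm x)\<^sup>2 - (cmod (ip x y))\<^sup>2 / (nrm y)\<^sup>2"
    using ip_nonneg[OF z] by (simp add: ip_self[OF x] flip: of_real_diff of_real_power of_real_divide)
  moreover have "nrm y > 0"
    using False nrm_nonneg[OF y] ip_self[OF y] by (cases "nrm y = 0") auto
  ultimately have "(cmod (ip x y))\<^sup>2 \<le> (nrm x * nrm y)\<^sup>2"
    by (simp add: field_simps)
  then show ?thesis
    by (rule power2_le_imp_le) (simp add: nrm_nonneg x y)
qed

lemma nrm_triangle:
  assumes x: "x \<in> H" and y: "y \<in> H"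
  shows "nrm (\<lambda>u. x u + y u) \<le> nrm x + nrm y"
proof (rule power2_le_imp_le)
  have "(nrm (\<lambda>u. x u + y u))\<^sup>2 = (nrm x)\<^sup>2 + 2 * Re (ip x y) + (nrm y)\<^sup>2"
    by (rule nrm_add_power2[OF x y])
  also have "Re (ip x y) \<le> nrm x * nrm y"
    using cauchy_schwarz[OF x y] complex_Re_le_cmod[of "ip x y"] by linarith
  finally show "(nrm (\<lambda>u. x u + y u))\<^sup>2 \<le> (nrm x + nrm y)\<^sup>2"
    by (simp add: power2_sum)
  show "0 \<le> nrm x + nrm y" using nrm_nonneg x y by simp
qed

lemma nrm_triangle_diff:
  assumes "x \<in> H" "y \<in> H" "z \<in> H"
  shows "nrm (\<lambda>u. x u - z u) \<le> nrm (\<lambda>u. x u - y u) + nrm (\<lambda>u. y u - z u)"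
  using nrm_triangle[OF diff_mem[OF assms(1,2)] diff_mem[OF assms(2,3)]] by simp

lemma ip_tendsto_left:
  assumes X: "\<And>n. X n \<in> H" and h: "h \<in> H" and lim: "(\<lambda>n. nrm (\<lambda>u. X n u - h u)) \<longlonglongrightarrow> 0"
    and y: "y \<in> H"
  shows "(\<lambda>n. ip (X n) y) \<longlonglongrightarrow> ip h y"
proof (rule LIM_zero_cancel, rule Lim_null_comparison)
  show "\<forall>\<^sub>F n in sequentially. norm (ip (X n) y - ip h y) \<le> nrm (\<lambda>u. X n u - h u) * nrm y"
    using cauchy_schwarz[OF diff_mem[OF X h] y] by (simp add: ip_diff X h y)
  show "(\<lambda>n. nrm (\<lambda>u. X n u - h u) * nrm y) \<longlonglongrightarrow> 0"
    using tendsto_mult_left_zero[OF lim] .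
qed

lemma ip_tendsto_right:
  assumes X: "\<And>n. X n \<in> H" and h: "h \<in> H" and lim: "(\<lambda>n. nrm (\<lambda>u. X n u - h u)) \<longlonglongrightarrow> 0"
    and y: "y \<in> H"
  shows "(\<lambda>n. ip y (X n)) \<longlonglongrightarrow> ip y h"
  using tendsto_cnj[OF ip_tendsto_left[OF X h lim y]] by (simp add: ip_sym[OF X y] ip_sym[OF h y])

lemma fun_span_subset: "G \<subseteq> H \<Longrightarrow> h \<in> fun_span G \<Longrightarrow> h \<in> H"
  by (erule fun_span.induct) (auto simp: zero_mem add_mem scale_mem)

text \<open>The vectors with the same exponential growth bound under powers of \<open>S T\<close> form a subspace, so the
  bound on the generators passes to their span; log-convexity of the norms of the iterates then
  removes the vector-dependent constant.\<close>
lemma bounded_on_fun_span: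
  assumes G: "G \<subseteq> H" and T: "fun_linear T" and S: "fun_linear S"
    and TG: "\<And>g. g \<in> G \<Longrightarrow> T g \<in> G" and SG: "\<And>g. g \<in> G \<Longrightarrow> S g \<in> G"
    and adj: "\<And>g h. \<lbrakk>g \<in> G; h \<in> G\<rbrakk> \<Longrightarrow> ip (T g) h = ip g (S h)"
    and Tb: "\<And>g. g \<in> G \<Longrightarrow> nrm (T g) \<le> R * nrm g"
    and Sb: "\<And>g. g \<in> G \<Longrightarrow> nrm (S g) \<le> R * nrm g" and R: "R \<ge> 0"
    and x: "x \<in> fun_span G"
  shows "nrm (T x) \<le> R * nrm x"
proof -
  let ?D = "fun_span G"
  note DH = fun_span_subset[OF G]
  have TD: "T y \<in> ?D" if "y \<in> ?D" for y
    using fun_span_image[OF T _ that] TG fun_span_superset by blast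
  have SD: "S y \<in> ?D" if "y \<in> ?D" for y
    using fun_span_image[OF S _ that] SG fun_span_superset by blast
  \<comment> \<open>The adjoint relation passes from generators to the span one argument at a time,
    the second argument first.\<close>
  have adj1: "ip (T g) y = ip g (S y)" if "g \<in> G" "y \<in> ?D" for g y
    using that(2)
  proof induction
    case (step h k c)
    then show ?case
      using that G TG SG SD[OF step(1)] DH
      by (simp add: subset_iff fun_linear_add[OF S] fun_linear_scale[OF S] ip_add_right
          ip_scale_right scale_mem adj)
  next
    case zero
    show ?case using that(1) G TG by (simp add: subset_iff ip_zero fun_linear_zero[OF S])
  qed
  have adjD: "ip (T z) y = ip z (S y)" if "z \<in> ?D" "y \<in> ?D" for z y
    using that(1)
  proof induction
    case (step h k c)
    then show ?case
      using that(2) G TG TD[OF step(1)] SD[OF that(2)] DH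
      by (simp add: subset_iff fun_linear_add[OF T] fun_linear_scale[OF T] ip_add
          ip_scale scale_mem adj1)
  next
    case zero
    show ?case using DH[OF that(2)] DH[OF SD[OF that(2)]]
      by (simp add: ip_zero fun_linear_zero[OF T])
  qed
  have adjD': "ip (S z) y = ip z (T y)" if "z \<in> ?D" "y \<in> ?D" for z y
    using adjD[OF that(2,1)] that SD TD DH by (metis ip_sym)
  \<comment> \<open>On the span \<open>P\<close> is symmetric, and the square of
    \<open>nrm (T x)\<close> equals \<open>ip x (P x)\<close>; by Cauchy-Schwarz a bound on
    \<open>P x\<close> therefore suffices.\<close>
  define P where "P = S \<circ> T"
  have P: "fun_linear P" by (simp add: P_def fun_linear_compose S T)
  have PD: "(P ^^ m) y \<in> ?D" if "y \<in> ?D" for m y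
    using that by (induction m) (auto simp: P_def SD TD)
  have PH: "(P ^^ m) y \<in> H" if "y \<in> ?D" for m y
    using PD[OF that] DH by blast
  have symm: "ip (P z) y = ip z (P y)" if "z \<in> ?D" "y \<in> ?D" for z y
    using that by (simp add: P_def adjD' adjD TD)
  have PG1: "P g \<in> G \<and> nrm (P g) \<le> R\<^sup>2 * nrm g" if g: "g \<in> G" for g
  proof -
    have "nrm (P g) \<le> R * nrm (T g)" using Sb[OF TG[OF g]] by (simp add: P_def)
    also have "\<dots> \<le> R * (R * nrm g)" using R Tb[OF g] by (rule mult_left_mono[rotated])
    finally show ?thesis using SG[OF TG[OF g]] by (simp add: P_def power2_eq_square mult.assoc)
  qed
  \<comment> \<open>Since \<open>P\<close> maps \<open>G\<close> into itself, the one-step bound can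
    be iterated on a generator.\<close>
  have PG: "(P ^^ m) g \<in> G \<and> nrm ((P ^^ m) g) \<le> nrm g * (R\<^sup>2) ^ m" if g: "g \<in> G" for g m
  proof (induction m)
    case (Suc m)
    have "nrm (P ((P ^^ m) g)) \<le> R\<^sup>2 * nrm ((P ^^ m) g)" using PG1 Suc by blast
    also have "\<dots> \<le> R\<^sup>2 * (nrm g * (R\<^sup>2) ^ m)"
      using Suc by (intro mult_left_mono) auto
    finally show ?case using PG1[of "(P ^^ m) g"] Suc by (simp add: mult_ac)
  qed (simp add: g)
  have "\<exists>C. \<forall>m. nrm ((P ^^ m) x) \<le> C * (R\<^sup>2) ^ m"
    using x
  proof induction
    case zero
    have "nrm (\<lambda>x. 0) = 0" by (simp add: ip_norm_def ip_zero zero_mem)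
    then show ?case by (intro exI[of _ 0]) (simp add: fun_linear_zero[OF fun_linear_funpow[OF P]])
  next
    case (step h k c)
    then obtain C where C: "nrm ((P ^^ m) h) \<le> C * (R\<^sup>2) ^ m" for m by blast
    have "nrm ((P ^^ m) (\<lambda>x. h x + c * k x)) \<le> (C + cmod c * nrm k) * (R\<^sup>2) ^ m" for m
    proof -
      have kH: "(P ^^ m) k \<in> H" using PG[OF step(2)] G by blast
      have "nrm ((P ^^ m) (\<lambda>x. h x + c * k x)) = nrm (\<lambda>x. (P ^^ m) h x + c * (P ^^ m) k x)"
        by (simp only: fun_linear_add[OF fun_linear_funpow[OF P]] fun_linear_scale[OF fun_linear_funpow[OF P]])
      also have "\<dots> \<le> nrm ((P ^^ m) h) + cmod c * nrm ((P ^^ m) k)"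
        using nrm_triangle[OF PH[OF step(1)] scale_mem[OF kH]] by (simp add: nrm_scale kH)
      also have "\<dots> \<le> C * (R\<^sup>2) ^ m + cmod c * (nrm k * (R\<^sup>2) ^ m)"
        using C PG[OF step(2)] by (intro add_mono mult_left_mono) auto
      finally show ?thesis by (simp add: algebra_simps)
    qed
    then show ?case by blast
  qed
  then obtain C where C: "nrm ((P ^^ m) x) \<le> C * (R\<^sup>2) ^ m" for m by blast
  have "nrm ((P ^^ 1) x) \<le> R\<^sup>2 * nrm ((P ^^ 0) x)"
  proof (rule log_convex_exponential_growth[where a = "\<lambda>m. nrm ((P ^^ m) x)" and C = C])
    \<comment> \<open>Symmetry moves one factor \<open>P\<close> across the inner product;
      Cauchy-Schwarz then gives log-convexity of the norms of the iterates.\<close>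
    show "(nrm ((P ^^ Suc m) x))\<^sup>2 \<le> nrm ((P ^^ m) x) * nrm ((P ^^ Suc (Suc m)) x)" for m
    proof -
      have "(nrm ((P ^^ Suc m) x))\<^sup>2 = Re (ip ((P ^^ m) x) ((P ^^ Suc (Suc m)) x))"
        using symm[OF PD[OF x, of m] PD[OF x, of "Suc m"]]
        by (simp add: nrm_power2[OF PH[OF x]] del: funpow.simps(2)) simp
      also have "\<dots> \<le> nrm ((P ^^ m) x) * nrm ((P ^^ Suc (Suc m)) x)"
        using cauchy_schwarz[OF PH[OF x] PH[OF x]] complex_Re_le_cmod order_trans by blast
      finally show ?thesis .
    qed
  qed (use C PH[OF x] nrm_nonneg in auto)
  then have Px: "nrm (P x) \<le> R\<^sup>2 * nrm x" by simp
  have xH: "x \<in> H" using DH x by blast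
  have "(nrm (T x))\<^sup>2 = Re (ip x (P x))"
    using adjD[OF x TD[OF x]] DH[OF TD[OF x]] by (simp add: nrm_power2 P_def)
  also have "\<dots> \<le> nrm x * nrm (P x)"
    using cauchy_schwarz[OF xH PH[OF x, of 1]] complex_Re_le_cmod[of "ip x (P x)"] by simp
  also have "\<dots> \<le> nrm x * (R\<^sup>2 * nrm x)"
    using Px nrm_nonneg[OF xH] by (rule mult_left_mono)
  finally have "(nrm (T x))\<^sup>2 \<le> (R * nrm x)\<^sup>2" by (simp add: power2_eq_square algebra_simps)
  then show ?thesis
    by (rule power2_le_imp_le) (simp add: R nrm_nonneg[OF xH])
qed

text \<open>Applied to \<open>u = h - x\<close>, where \<open>x\<close> is an almost closest point to \<open>h\<close> in a subspace containing \<open>y\<close>.\<close>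
lemma near_minimizer_almost_orthogonal:
  assumes u: "u \<in> H" and y: "y \<in> H" and e: "e \<ge> 0"
    and min: "\<And>t. (nrm u)\<^sup>2 \<le> (nrm (\<lambda>x. u x - t * y x))\<^sup>2 + e"
  shows "(cmod (ip u y))\<^sup>2 \<le> ((nrm y)\<^sup>2 + 1) * e"
proof -
  define N where "N = (nrm y)\<^sup>2"
  \<comment> \<open>With \<open>t\<close> equal to \<open>s\<close> times \<open>ip u y\<close>, the
    squared distance is quadratic in \<open>s\<close> with minimum at \<open>1 / N\<close>. Using
    \<open>N + 1\<close> costs only a constant and covers the case \<open>N = 0\<close>.\<close>
  define s where "s = 1 / (N + 1)"
  have N: "N \<ge> 0" by (simp add: N_def)
  have s: "s > 0" "s * N \<le> 1" using N by (simp_all add: s_def field_simps)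
  define t where "t = of_real s * ip u y"
  define a where "a = (cmod (ip u y))\<^sup>2"
  have a: "a \<ge> 0" by (simp add: a_def)
  have "ip u (\<lambda>x. t * y x) = of_real (s * a)"
    by (simp only: ip_scale_right u y t_def a_def of_real_mult complex_norm_square complex_cnj_mult
        complex_cnj_complex_of_real) (simp add: mult_ac)
  moreover have "(nrm (\<lambda>x. t * y x))\<^sup>2 = s\<^sup>2 * a * N"
    by (simp add: nrm_scale y t_def norm_mult power_mult_distrib a_def N_def)
  ultimately have "2 * (s * a) \<le> s\<^sup>2 * a * N + e"
    using min[of t] nrm_diff_power2[OF u scale_mem[OF y], of t] by simp
  also have "s\<^sup>2 * a * N = (s * a) * (s * N)" by (simp add: power2_eq_square)
  also have "\<dots> \<le> (s * a) * 1" using s a by (intro mult_left_mono) auto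
  finally have "s * a \<le> e" by linarith
  then have "a \<le> (N + 1) * e" using N by (simp add: s_def field_simps)
  then show ?thesis by (simp add: a_def N_def)
qed

text \<open>A sequence in the span that minimizes the distance to \<open>h\<close> is Cauchy by the
  parallelogram law. Its limit \<open>p\<close> leaves a remainder \<open>h - p\<close> orthogonal
  to \<open>G\<close>, and totality makes this remainder zero.\<close>

lemma dense_if_total:
  assumes GH: "G \<subseteq> H" and total: "\<And>h. \<lbrakk>h \<in> H; \<And>g. g \<in> G \<Longrightarrow> ip h g = 0\<rbrakk> \<Longrightarrow> h = (\<lambda>x. 0)"
    and h: "h \<in> H"
  obtains X where "\<And>n::nat. X n \<in> fun_span G" "(\<lambda>n. nrm (\<lambda>x. X n x - h x)) \<longlonglongrightarrow> 0"
proof -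
  let ?D = "fun_span G"
  note DH = fun_span_subset[OF GH]
  let ?q = "\<lambda>y. (nrm (\<lambda>x. h x - y x))\<^sup>2"
  define \<delta> where "\<delta> = Inf (?q ` ?D)"
  have bdd: "bdd_below (?q ` ?D)" by (rule bdd_belowI2[of _ 0]) simp
  have \<delta>: "\<delta> \<le> ?q y" if "y \<in> ?D" for y
    unfolding \<delta>_def using that bdd by (intro cInf_lower) auto
  have "\<exists>y\<in>?D. ?q y < \<delta> + 1 / Suc n" for n
  proof -
    have "?q ` ?D \<noteq> {}" using fun_span.zero by blast
    then show ?thesis
      using cInf_lessD[of "?q ` ?D" "\<delta> + 1 / Suc n"] unfolding \<delta>_def by fastforce
  qed
  then obtain X where X: "\<And>n. X n \<in> ?D" and Xq: "\<And>n. ?q (X n) < \<delta> + 1 / Suc n"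
    by metis
  have XH: "X n \<in> H" for n using X DH by blast
  have hX: "(\<lambda>x. h x - X n x) \<in> H" for n by (simp add: diff_mem h XH)
  have orth: "(cmod (ip (\<lambda>x. h x - X n x) y))\<^sup>2 \<le> ((nrm y)\<^sup>2 + 1) * (1 / Suc n)"
    if "y \<in> ?D" for y n
  proof (rule near_minimizer_almost_orthogonal[OF hX DH[OF that]])
    fix t
    have "\<delta> \<le> ?q (\<lambda>x. X n x + t * y x)"
      using that X by (intro \<delta> fun_span_add fun_span_scale)
    then show "?q (X n) \<le> (nrm (\<lambda>x. h x - X n x - t * y x))\<^sup>2 + 1 / Suc n"
      using Xq[of n] by (simp add: diff_diff_eq)
  qed simp
  \<comment> \<open>The midpoint of \<open>X k\<close> and \<open>X m\<close> lies in the span, so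
    its squared distance to \<open>h\<close> is at least \<open>\<delta>\<close>. In the
    parallelogram law this leaves only the excesses of \<open>X k\<close> and \<open>X m\<close>
    over \<open>\<delta>\<close>.\<close>
  have par: "(nrm (\<lambda>x. X k x - X m x))\<^sup>2 \<le> 2 / Suc k + 2 / Suc m" for k m
  proof -
    let ?u = "\<lambda>x. h x - X k x" and ?v = "\<lambda>x. h x - X m x"
    have "\<delta> \<le> ?q (\<lambda>x. (1/2) * (X k x + X m x))"
      using X by (intro \<delta> fun_span_scale fun_span_add)
    also have "(\<lambda>x. h x - (1/2) * (X k x + X m x)) = (\<lambda>x. (1/2) * (?u x + ?v x))"
      by (simp add: fun_eq_iff field_simps)
    also have "(nrm \<dots>)\<^sup>2 = (nrm (\<lambda>x. ?u x + ?v x))\<^sup>2 / 4"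
      by (simp only: nrm_scale[OF add_mem[OF hX hX]]) (simp add: power_divide)
    also have "(nrm (\<lambda>x. ?u x + ?v x))\<^sup>2 = (nrm ?u)\<^sup>2 + 2 * Re (ip ?u ?v) + (nrm ?v)\<^sup>2"
      by (rule nrm_add_power2[OF hX hX])
    finally have 1: "4 * \<delta> \<le> (nrm ?u)\<^sup>2 + 2 * Re (ip ?u ?v) + (nrm ?v)\<^sup>2" by simp
    have 2: "(nrm (\<lambda>x. ?u x - ?v x))\<^sup>2 = (nrm ?u)\<^sup>2 - 2 * Re (ip ?u ?v) + (nrm ?v)\<^sup>2"
      by (rule nrm_diff_power2[OF hX hX])
    have "nrm (\<lambda>x. ?u x - ?v x) = nrm (\<lambda>x. X k x - X m x)"
      using nrm_minus_commute[OF XH XH, of k m] by simp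
    then show ?thesis using 1 2 Xq[of k] Xq[of m] by simp
  qed
  have "\<exists>N. \<forall>k\<ge>N. \<forall>m\<ge>N. nrm (\<lambda>x. X k x - X m x) < e" if e: "e > 0" for e
  proof -
    obtain N where N: "4 / e\<^sup>2 < real N" using reals_Archimedean2 by blast
    have "nrm (\<lambda>x. X k x - X m x) < e" if "k \<ge> N" "m \<ge> N" for k m
    proof (rule power2_less_imp_less)
      have Np: "real N > 0" using N e by (smt (verit) divide_pos_pos zero_less_power)
      have "2 / Suc k \<le> 2 / real N" "2 / Suc m \<le> 2 / real N"
        using that Np by (auto intro!: divide_left_mono)
      then have "(nrm (\<lambda>x. X k x - X m x))\<^sup>2 \<le> 4 / real N"
        using par[of k m] by simp
      also have "\<dots> < e\<^sup>2" using N Np e by (simp add: field_simps)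
      finally show "(nrm (\<lambda>x. X k x - X m x))\<^sup>2 < e\<^sup>2" .
    qed (use e in simp)
    then show ?thesis by blast
  qed
  then obtain p where p: "p \<in> H" and lim: "(\<lambda>n. nrm (\<lambda>x. X n x - p x)) \<longlonglongrightarrow> 0"
    using complete[of X] XH by blast
  have "ip (\<lambda>x. h x - p x) g = 0" if "g \<in> G" for g
  proof -
    have gD: "g \<in> ?D" and gH: "g \<in> H" using that fun_span_superset GH by auto
    have "(\<lambda>n. (cmod (ip h g - ip (X n) g))\<^sup>2) \<longlonglongrightarrow> (cmod (ip h g - ip p g))\<^sup>2"
      by (intro tendsto_intros ip_tendsto_left[OF XH p lim gH])
    moreover have "(\<lambda>n. (cmod (ip h g - ip (X n) g))\<^sup>2) \<longlonglongrightarrow> 0"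
    proof (rule Lim_null_comparison)
      show "\<forall>\<^sub>F n in sequentially. norm ((cmod (ip h g - ip (X n) g))\<^sup>2) \<le> ((nrm g)\<^sup>2 + 1) * (1 / Suc n)"
        using orth[OF gD] by (simp add: ip_diff h XH gH)
      show "(\<lambda>n. ((nrm g)\<^sup>2 + 1) * (1 / Suc n)) \<longlonglongrightarrow> 0"
        using tendsto_mult_right_zero[OF LIMSEQ_inverse_real_of_nat] by (simp add: divide_inverse)
    qed
    ultimately have "(cmod (ip h g - ip p g))\<^sup>2 = 0" by (rule LIMSEQ_unique)
    then show ?thesis by (simp add: ip_diff h p gH)
  qed
  then have "(\<lambda>x. h x - p x) = (\<lambda>x. 0)" using total[OF diff_mem[OF h p]] by blast
  then have "p = h" by (simp add: fun_eq_iff)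
  then show thesis using that[OF X] lim by simp
qed

lemma nrm_tendsto:
  assumes X: "\<And>n. X n \<in> H" and h: "h \<in> H" and lim: "(\<lambda>n. nrm (\<lambda>u. X n u - h u)) \<longlonglongrightarrow> 0"
  shows "(\<lambda>n. nrm (X n)) \<longlonglongrightarrow> nrm h"
proof (rule LIM_zero_cancel, rule Lim_null_comparison[OF _ lim], rule always_eventually, rule allI)
  fix n
  have "nrm (X n) \<le> nrm (\<lambda>u. X n u - h u) + nrm h"
    using nrm_triangle[OF diff_mem[OF X h] h, of n] by simp
  moreover have "nrm h \<le> nrm (\<lambda>u. X n u - h u) + nrm (X n)"
    using nrm_triangle[OF diff_mem[OF h X] X, of n n] nrm_minus_commute[OF h X, of n] by simp
  ultimately show "norm (nrm (X n) - nrm h) \<le> nrm (\<lambda>u. X n u - h u)" by simp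
qed

end

section \<open>Adjoint pairs of self-maps of the ball\<close>

lemma
  shows herm_add_left: "herm (x + y) w = herm x w + herm y w"
    and herm_diff_right: "herm w (x - y) = herm w x - herm w y"
    and herm_scale_left: "herm (c *s x) w = c * herm x w"
    and herm_scale_right: "herm w (c *s x) = cnj c * herm w x"
    and herm_zero_left [simp]: "herm 0 w = 0"
    and herm_zero_right [simp]: "herm w 0 = 0"
  by (simp_all add: herm_def algebra_simps sum.distrib sum_subtractf sum_distrib_left)

lemma cnj_herm: "cnj (herm x y) = herm y x"
  by (simp add: herm_def mult.commute)

lemma herm_adjoint: "herm (A *v z) w = herm z (adjoint_mat A *v w)"
proof -
  have "herm (A *v z) w = (\<Sum>i\<in>UNIV. \<Sum>j\<in>UNIV. A $ i $ j * z $ j * cnj (w $ i))"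
    by (simp add: herm_def matrix_vector_mult_def sum_distrib_right)
  also have "\<dots> = (\<Sum>j\<in>UNIV. \<Sum>i\<in>UNIV. A $ i $ j * z $ j * cnj (w $ i))"
    by (rule sum.swap)
  also have "\<dots> = herm z (adjoint_mat A *v w)"
    by (simp add: herm_def matrix_vector_mult_def adjoint_mat_def sum_distrib_left mult_ac)
  finally show ?thesis .
qed

lemma herm_self: "herm z z = of_real ((norm z)\<^sup>2)"
  by (simp add: herm_def norm_vec_def L2_set_def sum_nonneg flip: complex_norm_square)

lemma norm_herm_le: "cmod (herm z w) \<le> norm z * norm w"
proof -
  have "cmod (herm z w) \<le> (\<Sum>j\<in>UNIV. \<bar>norm (z $ j)\<bar> * \<bar>norm (w $ j)\<bar>)"
    unfolding herm_def by (rule sum_norm_le) (simp add: norm_mult)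
  also have "\<dots> \<le> norm z * norm w"
    unfolding norm_vec_def by (rule L2_set_mult_ineq)
  finally show ?thesis .
qed

lemma norm_scalar_mult: "norm (c *s x) = cmod c * norm (x :: complex^'n)"
  by (simp add: norm_vec_def norm_mult L2_set_right_distrib)

lemma norm_one_minus_herm_ge: "norm w \<le> 1 \<Longrightarrow> 1 - norm z \<le> cmod (1 - herm z w)"
  using norm_herm_le[of z w] norm_triangle_ineq2[of 1 "herm z w"] mult_left_le[of "norm w" "norm z"]
  by simp

lemma Re_one_minus_herm_pos: "\<lbrakk>norm z < 1; norm w \<le> 1\<rbrakk> \<Longrightarrow> 0 < Re (1 - herm z w)"
  using norm_herm_le[of z w] complex_Re_le_cmod[of "herm z w"] mult_left_le[of "norm w" "norm z"]
  by simp

text \<open>Both logarithms have imaginary part of modulus below \<open>pi / 2\<close>, so their sum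
  stays in the principal range.\<close>

lemma powr_mult_right_half_plane:
  fixes a b c :: complex
  assumes "Re a > 0" "Re b > 0"
  shows "(a * b) powr c = a powr c * b powr c"
proof -
  have "a \<noteq> 0" "b \<noteq> 0" using assms by auto
  moreover have "\<bar>Im (Ln a)\<bar> < pi / 2" "\<bar>Im (Ln b)\<bar> < pi / 2"
    using assms Re_Ln_pos_lt calculation by blast+
  ultimately have "Ln (a * b) = Ln a + Ln b"
    by (intro Ln_times_simple) auto
  then show ?thesis using \<open>a \<noteq> 0\<close> \<open>b \<noteq> 0\<close> by (simp add: powr_def distrib_left exp_add)
qed

lemma powr_base_inject:
  fixes x y r :: real
  assumes "x powr r = y powr r" "0 \<le> x" "0 \<le> y" "r \<noteq> 0"
  shows "x = y"
  using arg_cong[OF assms(1), of "\<lambda>t. t powr (1 / r)"] assms(2-4) by (simp add: powr_powr)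

lemma norm_powr_of_real: "cmod (z powr of_real r) = cmod z powr r"
  by (simp add: powr_def norm_exp_eq_Re)

text \<open>This keeps all that the operator theory needs from the matrix data. For linear
  fractional maps, \<open>1 - herm z (\<sigma> 0)\<close> is the denominator of \<phi> normalized to
  be 1 at the origin, and \<open>1 - herm (\<phi> 0) w\<close> is the conjugate of the normalized
  denominator of \<sigma>.\<close>

definition adjoint_pair ::
  "(complex^'n \<Rightarrow> complex^'n) \<Rightarrow> (complex^'n \<Rightarrow> complex^'n) \<Rightarrow> bool" where
  "adjoint_pair \<phi> \<sigma> \<longleftrightarrow> \<phi> ` ball 0 1 \<subseteq> ball 0 1 \<and> \<sigma> ` ball 0 1 \<subseteq> ball 0 1 \<and>
     (\<forall>z\<in>ball 0 1. \<forall>w\<in>ball 0 1.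
        (1 - herm (\<phi> z) w) * (1 - herm z (\<sigma> 0)) = (1 - herm (\<phi> 0) w) * (1 - herm z (\<sigma> w)))"

lemma adjoint_pair_mem:
  assumes "adjoint_pair \<phi> \<sigma>" "norm z < 1"
  shows "norm (\<phi> z) < 1" "norm (\<sigma> z) < 1"
  using assms by (auto simp: adjoint_pair_def image_subset_iff)

lemma adjoint_pair_identity:
  assumes "adjoint_pair \<phi> \<sigma>" "norm z < 1" "norm w < 1"
  shows "(1 - herm (\<phi> z) w) * (1 - herm z (\<sigma> 0)) = (1 - herm (\<phi> 0) w) * (1 - herm z (\<sigma> w))"
  using assms by (auto simp: adjoint_pair_def)

text \<open>Conjugating the identity with \<open>z\<close> and \<open>w\<close> exchanged gives the
  identity for the swapped pair. Every result about one operator thus holds for its prospective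
  adjoint.\<close>

lemma adjoint_pair_sym:
  assumes "adjoint_pair \<phi> \<sigma>"
  shows "adjoint_pair \<sigma> \<phi>"
proof -
  have "(1 - herm (\<sigma> z) w) * (1 - herm z (\<phi> 0)) = (1 - herm (\<sigma> 0) w) * (1 - herm z (\<phi> w))"
    if "norm z < 1" "norm w < 1" for z w
    using arg_cong[OF adjoint_pair_identity[OF assms that(2,1)], of cnj]
    by (simp add: cnj_herm mult.commute)
  then show ?thesis using assms by (auto simp: adjoint_pair_def)
qed

text \<open>The identity at \<open>w = \<phi> z\<close> gives a Schwarz--Pick estimate.\<close>
lemma adjoint_pair_schwarz_pick:
  assumes p: "adjoint_pair \<phi> \<sigma>" and z: "norm z < 1"
  shows "(1 - norm (\<phi> 0)) / 4 * (1 - (norm z)\<^sup>2) \<le> 1 - (norm (\<phi> z))\<^sup>2"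
proof -
  note m = adjoint_pair_mem[OF p]
  have z0: "norm (\<phi> z) < 1" "norm (\<phi> 0) < 1" "norm (\<sigma> 0) < 1" "norm (\<sigma> (\<phi> z)) < 1"
    using m z by auto
  have "1 - herm (\<phi> z) (\<phi> z) = of_real (1 - (norm (\<phi> z))\<^sup>2)"
    by (simp add: herm_self)
  moreover have "(norm (\<phi> z))\<^sup>2 \<le> 1"
    using z0 by (simp add: power_le_one)
  ultimately have 1: "cmod (1 - herm (\<phi> z) (\<phi> z)) = 1 - (norm (\<phi> z))\<^sup>2"
    by (simp only: norm_of_real)
  have 2: "cmod (1 - herm z (\<sigma> 0)) \<le> 2"
  proof -
    have "cmod (1 - herm z (\<sigma> 0)) \<le> 1 + norm z * norm (\<sigma> 0)"
      using norm_triangle_ineq4[of 1 "herm z (\<sigma> 0)"] norm_herm_le[of z "\<sigma> 0"] by simp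
    also have "norm z * norm (\<sigma> 0) \<le> 1" using z z0 by (intro mult_le_one) auto
    finally show ?thesis by simp
  qed
  \<comment> \<open>The lower bound concerns the right side of the identity at
    \<open>w = \<phi> z\<close>, whose left side contains
    \<open>1 - herm (\<phi> z) (\<phi> z)\<close>.\<close>
  have "(1 - norm (\<phi> 0)) * (1 - norm z) \<le> cmod (1 - herm (\<phi> 0) (\<phi> z)) * cmod (1 - herm z (\<sigma> (\<phi> z)))"
    using z z0 by (intro mult_mono norm_one_minus_herm_ge) auto
  also have "\<dots> = (1 - (norm (\<phi> z))\<^sup>2) * cmod (1 - herm z (\<sigma> 0))"
    using arg_cong[OF adjoint_pair_identity[OF p z z0(1)], of cmod] by (simp add: norm_mult 1)
  also have "\<dots> \<le> (1 - (norm (\<phi> z))\<^sup>2) * 2"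
    using 2 \<open>(norm (\<phi> z))\<^sup>2 \<le> 1\<close> by (intro mult_left_mono) auto
  finally have a: "(1 - norm (\<phi> 0)) * (1 - norm z) \<le> (1 - (norm (\<phi> z))\<^sup>2) * 2" .
  \<comment> \<open>The 4 in the statement is the product of two bounds by 2: one for
    \<open>cmod (1 - herm z (\<sigma> 0))\<close>, one for \<open>1 + norm z\<close>.\<close>
  have "1 - (norm z)\<^sup>2 = (1 + norm z) * (1 - norm z)" by (simp add: power2_eq_square algebra_simps)
  also have "\<dots> \<le> 2 * (1 - norm z)" using z by (intro mult_right_mono) auto
  finally have "(1 - norm (\<phi> 0)) * (1 - (norm z)\<^sup>2) \<le> (1 - norm (\<phi> 0)) * (2 * (1 - norm z))"
    using z0 by (intro mult_left_mono) auto
  also have "\<dots> = 2 * ((1 - norm (\<phi> 0)) * (1 - norm z))" by simp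
  finally show ?thesis using a by simp
qed

section \<open>Linear fractional maps and their adjoint maps\<close>

text \<open>With denominators cleared, both sides are
  \<open>herm z C + d - herm (A *v z) w - herm B w\<close>. The factor \<open>d - herm B w\<close>
  is the conjugate of the denominator of the adjoint map at \<open>w\<close>.\<close>

lemma lin_frac_identity:
  assumes "herm z C + d \<noteq> 0" "- herm w B + cnj d \<noteq> 0"
  shows "(1 - herm (lin_frac A B C d z) w) * (herm z C + d) =
    (d - herm B w) * (1 - herm z (adjoint_map A B C d w))"
proof -
  have "cnj (- herm w B + cnj d) = d - herm B w" by (simp add: cnj_herm)
  moreover have "d - herm B w \<noteq> 0" using assms(2) calculation by (metis complex_cnj_zero_iff)
  ultimately have "(d - herm B w) * herm z (adjoint_map A B C d w) = herm (A *v z) w - herm z C"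
    unfolding adjoint_map_def herm_scale_right herm_diff_right herm_adjoint
    by (simp add: complex_cnj_inverse)
  moreover have "herm (lin_frac A B C d z) w * (herm z C + d) = herm (A *v z) w + herm B w"
    using assms(1) unfolding lin_frac_def herm_scale_left herm_add_left by simp
  ultimately show ?thesis by (simp add: algebra_simps)
qed

lemma lin_frac_adjoint_pair:
  assumes "lin_frac_self_map A B C d"
  shows "adjoint_pair (lin_frac A B C d) (adjoint_map A B C d)"
proof -
  let ?\<phi> = "lin_frac A B C d" and ?\<sigma> = "adjoint_map A B C d"
  have Cd: "norm C < cmod d" and \<phi>b: "\<And>z. norm z < 1 \<Longrightarrow> norm (?\<phi> z) < 1"
    using assms by (auto simp: lin_frac_self_map_def image_subset_iff)
  have d0: "d \<noteq> 0" using Cd by auto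
  have "?\<phi> 0 = inverse d *s B" by (simp add: lin_frac_def)
  then have Bd: "norm B < cmod d"
    using \<phi>b[of 0] d0 by (simp add: norm_scalar_mult norm_inverse norm_divide divide_simps)
  have nz: "herm z E + e \<noteq> 0" if "norm z \<le> 1" "norm E < cmod e" for z E :: "complex^'n" and e
  proof
    assume "herm z E + e = 0"
    then have "cmod e = cmod (herm z E)" by (metis add_eq_0_iff norm_minus_cancel)
    also have "\<dots> \<le> norm E"
      using norm_herm_le[of z E] mult_right_mono[OF that(1), of "norm E"] by simp
    finally show False using that by simp
  qed
  have den1: "herm z C + d \<noteq> 0" if "norm z \<le> 1" for z using nz[OF that Cd] .
  have den2: "- herm w B + cnj d \<noteq> 0" if "norm w \<le> 1" for w
    using nz[OF that, of B "- cnj d"] Bd by (simp add: add_eq_0_iff)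
  \<comment> \<open>The self-map property is extended to the closed ball by continuity, since the
    point \<open>z\<close> used below for \<sigma> may lie on the unit sphere.\<close>
  have \<phi>c: "norm (?\<phi> z) \<le> 1" if "norm z \<le> 1" for z
  proof (rule continuous_le_on_closure[of "ball 0 1" "\<lambda>z. norm (?\<phi> z)"])
    have "continuous_on (cball 0 1) (\<lambda>z. \<chi> i. inverse ((\<Sum>j\<in>UNIV. z $ j * cnj (C $ j)) + d) *
        ((\<Sum>j\<in>UNIV. A $ i $ j * z $ j) + B $ i))"
      using den1 by (intro continuous_intros) (auto simp: herm_def)
    moreover have "?\<phi> = (\<lambda>z. \<chi> i. inverse ((\<Sum>j\<in>UNIV. z $ j * cnj (C $ j)) + d) *
        ((\<Sum>j\<in>UNIV. A $ i $ j * z $ j) + B $ i))"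
      by (simp add: fun_eq_iff vec_eq_iff lin_frac_def herm_def matrix_vector_mult_def distrib_left)
    ultimately show "continuous_on (closure (ball 0 1)) (\<lambda>z. norm (?\<phi> z))"
      by (simp add: continuous_on_norm)
  qed (use that \<phi>b in \<open>auto intro: less_imp_le\<close>)
  have id: "(1 - herm (?\<phi> z) w) * (herm z C + d) = (d - herm B w) * (1 - herm z (?\<sigma> w))"
    if "norm z \<le> 1" "norm w \<le> 1" for z w
    using lin_frac_identity[OF den1[OF that(1)] den2[OF that(2)]] .
  text \<open>If \<open>\<sigma> w\<close> were outside the open ball, some \<open>z\<close> in the closed ball would have \<open>\<langle>z, \<sigma> w\<rangle> = 1\<close>, and
    the identity would force \<open>\<langle>\<phi> z, w\<rangle> = 1\<close>.\<close>
  have \<sigma>b: "norm (?\<sigma> w) < 1" if w: "norm w < 1" for w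
  proof (rule ccontr)
    assume "\<not> norm (?\<sigma> w) < 1"
    then have s: "norm (?\<sigma> w) \<ge> 1" by simp
    define z where "z = of_real (inverse ((norm (?\<sigma> w))\<^sup>2)) *s ?\<sigma> w"
    have s0: "norm (?\<sigma> w) \<noteq> 0" using s by linarith
    have "norm z = inverse (norm (?\<sigma> w))"
      using s0 unfolding z_def norm_scalar_mult norm_of_real
      by (simp add: power2_eq_square del: norm_eq_zero)
    then have z: "norm z \<le> 1" using s by (simp add: inverse_le_1_iff)
    have "herm z (?\<sigma> w) = 1"
      using s0 by (simp add: z_def herm_scale_left herm_self)
    then have "herm (?\<phi> z) w = 1"
      using id[OF z, of w] w den1[OF z] by simp
    moreover have "cmod (herm (?\<phi> z) w) < 1"
      using norm_herm_le[of "?\<phi> z" w] mult_right_mono[OF \<phi>c[OF z], of "norm w"] w by simp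
    ultimately show False by simp
  qed
  have "(1 - herm (?\<phi> z) w) * (1 - herm z (?\<sigma> 0)) = (1 - herm (?\<phi> 0) w) * (1 - herm z (?\<sigma> w))"
    if "norm z < 1" "norm w < 1" for z w
  proof -
    \<comment> \<open>Setting \<open>w = 0\<close> and then \<open>z = 0\<close> expresses both
      denominators through \<open>\<sigma> 0\<close> and \<open>\<phi> 0\<close>, which eliminates
      \<open>B\<close> and \<open>C\<close>.\<close>
    have *: "herm z C + d = d * (1 - herm z (?\<sigma> 0))" "d - herm B w = (1 - herm (?\<phi> 0) w) * d"
      using id[of z 0] id[of 0 w] that by simp_all
    then have "d * ((1 - herm (?\<phi> z) w) * (1 - herm z (?\<sigma> 0))) =
        d * ((1 - herm (?\<phi> 0) w) * (1 - herm z (?\<sigma> w)))"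
      using id[of z w, unfolded *] that by (simp only: less_imp_le mult_ac)
    then show ?thesis using d0 by simp
  qed
  then show ?thesis using \<phi>b \<sigma>b by (auto simp: adjoint_pair_def)
qed

section \<open>The reproducing kernel of the ball\<close>

lemma ball_kernel_apply:
  "norm w < 1 \<Longrightarrow> ball_kernel \<gamma> z w = (1 - herm w z) powr (- of_real \<gamma>)"
  by (simp add: ball_kernel_def)

lemma ball_kernel_outside: "\<not> norm w < 1 \<Longrightarrow> ball_kernel \<gamma> z w = 0"
  by (simp add: ball_kernel_def)

lemma norm_ball_kernel: "norm w < 1 \<Longrightarrow> cmod (ball_kernel \<gamma> z w) = cmod (1 - herm w z) powr (- \<gamma>)"
  using norm_powr_of_real[of "1 - herm w z" "- \<gamma>"] by (simp add: ball_kernel_apply)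

lemma cnj_ball_kernel:
  assumes "norm z < 1" "norm w < 1"
  shows "cnj (ball_kernel \<gamma> z w) = ball_kernel \<gamma> w z"
proof -
  have "0 < Re (1 - herm w z)" using Re_one_minus_herm_pos[of w z] assms by simp
  then have "cnj ((1 - herm w z) powr (- of_real \<gamma>)) = (1 - herm z w) powr (- of_real \<gamma>)"
    by (subst cnj_powr) (auto simp: cnj_herm)
  then show ?thesis using assms by (simp add: ball_kernel_apply)
qed

lemma ball_kernel_self:
  assumes "norm w < 1"
  shows "ball_kernel \<gamma> w w = of_real ((1 - (norm w)\<^sup>2) powr (- \<gamma>))"
proof -
  have "(norm w)\<^sup>2 \<le> 1" using assms by (simp add: power_le_one)
  then show ?thesis
    using powr_of_real[of "1 - (norm w)\<^sup>2" "- \<gamma>"] assms by (simp add: ball_kernel_apply herm_self)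
qed

lemma ball_kernel_0: "ball_kernel \<gamma> w 0 = 1" "norm z < 1 \<Longrightarrow> ball_kernel \<gamma> 0 z = 1"
  by (simp_all add: ball_kernel_apply)

lemma ball_kernel_nonzero: "\<lbrakk>norm z < 1; norm w < 1\<rbrakk> \<Longrightarrow> ball_kernel \<gamma> z w \<noteq> 0"
  using Re_one_minus_herm_pos[of w z] by (auto simp: ball_kernel_apply powr_def)

lemma ball_kernel_mult_eq:
  fixes z w z' w' u v u' v' :: "complex^'n"
  assumes "norm z < 1" "norm w < 1" "norm z' < 1" "norm w' < 1"
    and "norm u < 1" "norm v < 1" "norm u' < 1" "norm v' < 1"
    and "(1 - herm z w) * (1 - herm z' w') = (1 - herm u v) * (1 - herm u' v')"
  shows "ball_kernel \<gamma> w z * ball_kernel \<gamma> w' z' = ball_kernel \<gamma> v u * ball_kernel \<gamma> v' u'"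
proof -
  have *: "ball_kernel \<gamma> b a * ball_kernel \<gamma> b' a' = ((1 - herm a b) * (1 - herm a' b')) powr (- of_real \<gamma>)"
    if "norm a < 1" "norm b < 1" "norm a' < 1" "norm b' < 1" for a b a' b' :: "complex^'n"
    using that
    by (subst powr_mult_right_half_plane) (simp_all only: ball_kernel_apply Re_one_minus_herm_pos less_imp_le)
  show ?thesis using assms by (simp add: *)
qed

text \<open>Taking moduli turns the complex power into a real one, which can be undone. There remain
  equal moduli of \<open>1 - herm z a\<close> and \<open>1 - herm z b\<close>, and these determine
  the point.\<close>

lemma ball_kernel_inject:
  assumes \<gamma>: "\<gamma> > 0" and a: "norm a < 1" and b: "norm b < 1"
    and eq: "\<And>z. norm z < 1 \<Longrightarrow> ball_kernel \<gamma> a z = ball_kernel \<gamma> b z"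
  shows "a = b"
proof -
  have abs: "(cmod (1 - herm z a))\<^sup>2 = (cmod (1 - herm z b))\<^sup>2" if "norm z < 1" for z
  proof -
    have "cmod (1 - herm z a) powr (- \<gamma>) = cmod (1 - herm z b) powr (- \<gamma>)"
      using eq[OF that] that by (simp flip: norm_ball_kernel)
    then show ?thesis using \<gamma> powr_base_inject by fastforce
  qed
  \<comment> \<open>Since \<open>norm (a - b) < 2\<close>, this point is in the ball, and
    \<open>herm z (a - b)\<close> is half the squared norm of \<open>a - b\<close>.\<close>
  define z where "z = (1/2) *s (a - b)"
  have z: "norm z < 1" "norm ((1/2) *s z) < 1"
    using a b norm_triangle_ineq4[of a b] unfolding z_def norm_scalar_mult by simp_all
  have sq: "(cmod (1 - u))\<^sup>2 = 1 - 2 * Re u + (cmod u)\<^sup>2" for u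
    unfolding cmod_power2 by (simp add: power2_eq_square algebra_simps)
  \<comment> \<open>In the expansion of the squared modulus, halving \<open>z\<close> divides the
    linear term by 2 and the quadratic term by 4. The equations at \<open>z\<close> and at half of
    \<open>z\<close> therefore separate the two terms.\<close>
  have "Re (herm z a) = Re (herm z b)"
    using abs[OF z(1)] abs[OF z(2)] unfolding herm_scale_left sq
    by (simp add: norm_mult power_mult_distrib norm_divide power_divide)
  then have "Re (herm z (a - b)) = 0" by (simp add: herm_diff_right)
  then have "Re (1 / 2 * of_real ((norm (a - b))\<^sup>2)) = 0"
    unfolding z_def herm_scale_left herm_self .
  then show ?thesis by simp
qed

section \<open>Weighted composition operators\<close>

lemma fun_linear_weighted_comp: "fun_linear (weighted_comp f \<phi>)"
  by (auto simp: fun_linear_def weighted_comp_def fun_eq_iff algebra_simps)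

context ball_space
begin

abbreviation K :: "complex^'n \<Rightarrow> complex^'n \<Rightarrow> complex" where "K \<equiv> ball_kernel \<gamma>"

text \<open>The weight uses \<sigma> only through \<open>\<sigma> 0\<close>. Both maps are arguments
  so that the adjoint takes the form \<open>W \<sigma> \<phi>\<close>.\<close>

abbreviation W :: "(complex^'n \<Rightarrow> complex^'n) \<Rightarrow> (complex^'n \<Rightarrow> complex^'n) \<Rightarrow>
    (complex^'n \<Rightarrow> complex) \<Rightarrow> (complex^'n \<Rightarrow> complex)" where
  "W \<phi> \<sigma> \<equiv> weighted_comp (K (\<sigma> 0)) \<phi>"

text \<open>Scalar multiples are included so that the operators, which turn kernels into multiples
  of kernels, map the set into itself.\<close>

definition scaled_kernels :: "(complex^'n \<Rightarrow> complex) set" where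
  "scaled_kernels = {\<lambda>z. c * K w z | c w. norm w < 1}"

lemma K_mem: "norm w < 1 \<Longrightarrow> K w \<in> H"
  by (simp add: kernel_mem)

lemma ip_K: "\<lbrakk>norm w < 1; h \<in> H\<rbrakk> \<Longrightarrow> ip h (K w) = h w"
  by (simp add: reproducing)

lemma scaled_kernels_subset: "scaled_kernels \<subseteq> H"
  by (auto simp: scaled_kernels_def intro!: scale_mem K_mem)

lemma scaled_kernelsI: "norm w < 1 \<Longrightarrow> (\<lambda>z. c * K w z) \<in> scaled_kernels"
  by (auto simp: scaled_kernels_def)

lemma eqI_on_ball:
  assumes "g \<in> H" "h \<in> H" "\<And>z. norm z < 1 \<Longrightarrow> g z = h z"
  shows "g = h"
proof
  fix z
  show "g z = h z"
    using assms(3) vanish_outside[OF assms(1), of z] vanish_outside[OF assms(2), of z] by (cases "norm z < 1") auto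
qed

text \<open>By the reproducing property, a function orthogonal to every kernel vanishes on the ball,
  so the kernels are total.\<close>

lemma approx_by_kernels:
  assumes "h \<in> H"
  obtains X where "\<And>n::nat. X n \<in> fun_span scaled_kernels" "(\<lambda>n. nrm (\<lambda>x. X n x - h x)) \<longlonglongrightarrow> 0"
proof (rule dense_if_total[OF scaled_kernels_subset _ assms])
  fix h assume h: "h \<in> H" and orth: "\<And>g. g \<in> scaled_kernels \<Longrightarrow> ip h g = 0"
  show "h = (\<lambda>x. 0)"
  proof (rule eqI_on_ball[OF h zero_mem])
    fix z :: "complex^'n" assume z: "norm z < 1"
    show "h z = 0" using orth[OF scaled_kernelsI[OF z, of 1]] ip_K[OF z h] by simp
  qed
qed blast

section \<open>The operators on kernels and on their span\<close>

lemma weighted_comp_kernel: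
  assumes p: "adjoint_pair \<phi> \<sigma>" and w: "norm w < 1"
  shows "W \<phi> \<sigma> (K w) = (\<lambda>z. K w (\<phi> 0) * K (\<sigma> w) z)"
proof
  fix z
  show "W \<phi> \<sigma> (K w) z = K w (\<phi> 0) * K (\<sigma> w) z"
  proof (cases "norm z < 1")
    case True
    have "K w (\<phi> z) * K (\<sigma> 0) z = K w (\<phi> 0) * K (\<sigma> w) z"
      by (rule ball_kernel_mult_eq[OF _ _ _ _ _ _ _ _ adjoint_pair_identity[OF p True w]])
        (simp_all add: adjoint_pair_mem[OF p] True w)
    then show ?thesis using True by (simp add: weighted_comp_def mult.commute)
  qed (simp add: weighted_comp_def ball_kernel_outside)
qed

lemma weighted_comp_scaled_kernel:
  assumes "adjoint_pair \<phi> \<sigma>" "norm w < 1"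
  shows "W \<phi> \<sigma> (\<lambda>z. c * K w z) = (\<lambda>z. (c * K w (\<phi> 0)) * K (\<sigma> w) z)"
  by (simp only: fun_linear_scale[OF fun_linear_weighted_comp] weighted_comp_kernel[OF assms])
    (simp add: mult.assoc)

lemma weighted_comp_scaled_kernels_mem:
  assumes p: "adjoint_pair \<phi> \<sigma>" and "g \<in> scaled_kernels"
  shows "W \<phi> \<sigma> g \<in> scaled_kernels"
proof -
  obtain c w where g: "g = (\<lambda>z. c * K w z)" and w: "norm w < 1"
    using assms(2) by (auto simp: scaled_kernels_def)
  show ?thesis
    unfolding g weighted_comp_scaled_kernel[OF p w]
    by (rule scaled_kernelsI[OF adjoint_pair_mem(2)[OF p w]])
qed

lemma nrm_K: "norm w < 1 \<Longrightarrow> nrm (K w) = sqrt ((1 - (norm w)\<^sup>2) powr (- \<gamma>))"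
  by (simp add: ip_norm_def ip_K K_mem ball_kernel_self)

text \<open>The norm of \<open>K w\<close> is a negative power of
  \<open>1 - (norm w)\<^sup>2\<close>, so the Schwarz-Pick estimate for \<sigma> compares
  \<open>K (\<sigma> w)\<close> with \<open>K w\<close>. The scalar \<open>K w (\<phi> 0)\<close> is
  bounded in \<open>w\<close> because \<open>\<phi> 0\<close> is a fixed interior point.\<close>

lemma weighted_comp_bounded_scaled_kernels:
  assumes p: "adjoint_pair \<phi> \<sigma>" and \<gamma>: "\<gamma> > 0"
  obtains R where "R \<ge> 0" "\<And>g. g \<in> scaled_kernels \<Longrightarrow> nrm (W \<phi> \<sigma> g) \<le> R * nrm g"
proof -
  let ?a = "(1 - norm (\<phi> 0)) powr (- \<gamma>)" and ?b = "(1 - norm (\<sigma> 0)) / 4"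
  let ?R = "?a * sqrt (?b powr (- \<gamma>))"
  have 0: "norm (\<phi> 0) < 1" "norm (\<sigma> 0) < 1" by (simp_all add: adjoint_pair_mem[OF p])
  have "nrm (W \<phi> \<sigma> g) \<le> ?R * nrm g" if "g \<in> scaled_kernels" for g
  proof -
    from that obtain c w where g: "g = (\<lambda>z. c * K w z)" and w: "norm w < 1"
      by (auto simp: scaled_kernels_def)
    have sw: "norm (\<sigma> w) < 1" by (rule adjoint_pair_mem(2)[OF p w])
    have w2: "(norm w)\<^sup>2 < 1" using w by (simp add: power_less_one_iff)
    have "cmod (K w (\<phi> 0)) = cmod (1 - herm (\<phi> 0) w) powr (- \<gamma>)"
      using 0(1) by (rule norm_ball_kernel)
    also have "\<dots> \<le> ?a"
      using 0 w \<gamma> norm_one_minus_herm_ge[of w "\<phi> 0"] by (intro powr_mono2') auto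
    finally have a: "cmod (K w (\<phi> 0)) \<le> ?a" .
    have "(1 - (norm (\<sigma> w))\<^sup>2) powr (- \<gamma>) \<le> (?b * (1 - (norm w)\<^sup>2)) powr (- \<gamma>)"
      using adjoint_pair_schwarz_pick[OF adjoint_pair_sym[OF p] w] 0 w2 \<gamma>
      by (intro powr_mono2') auto
    also have "\<dots> = ?b powr (- \<gamma>) * (1 - (norm w)\<^sup>2) powr (- \<gamma>)"
      by (rule powr_mult)
    finally have b: "nrm (K (\<sigma> w)) \<le> sqrt (?b powr (- \<gamma>)) * nrm (K w)"
      by (simp only: nrm_K w sw real_sqrt_le_iff flip: real_sqrt_mult)
    have "nrm (W \<phi> \<sigma> g) = cmod c * (cmod (K w (\<phi> 0)) * nrm (K (\<sigma> w)))"
      unfolding g weighted_comp_scaled_kernel[OF p w]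
      by (simp only: nrm_scale[OF K_mem[OF sw]] norm_mult)
    also have "\<dots> \<le> cmod c * (?a * (sqrt (?b powr (- \<gamma>)) * nrm (K w)))"
      using a b nrm_nonneg[OF K_mem[OF sw]] by (intro mult_left_mono mult_mono) auto
    also have "\<dots> = ?R * nrm g"
      unfolding g by (simp add: nrm_scale K_mem w)
    finally show ?thesis .
  qed
  moreover have "?R \<ge> 0" by simp
  ultimately show thesis using that by blast
qed

text \<open>Against a kernel both sides become point evaluations of \<open>g\<close> at
  \<open>\<phi> w\<close>, with weights that agree by the conjugate symmetry of the kernel.
  Membership of the image of \<open>g\<close> is a hypothesis so that the relation is available
  before boundedness is known.\<close>

lemma weighted_comp_adjoint_scaled_kernels:
  assumes p: "adjoint_pair \<phi> \<sigma>" and g: "g \<in> H" "W \<phi> \<sigma> g \<in> H" and "h \<in> scaled_kernels"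
  shows "ip (W \<phi> \<sigma> g) h = ip g (W \<sigma> \<phi> h)"
proof -
  obtain c w where h: "h = (\<lambda>z. c * K w z)" and w: "norm w < 1"
    using assms(4) by (auto simp: scaled_kernels_def)
  have m: "norm (\<phi> w) < 1" "norm (\<sigma> 0) < 1" by (simp_all add: adjoint_pair_mem[OF p] w)
  show ?thesis
    unfolding h weighted_comp_scaled_kernel[OF adjoint_pair_sym[OF p] w]
    using g w m
    by (simp only: ip_scale_right K_mem ip_K) (simp add: weighted_comp_def cnj_ball_kernel)
qed

lemma weighted_comp_bounded_span:
  assumes p: "adjoint_pair \<phi> \<sigma>" and \<gamma>: "\<gamma> > 0"
  obtains R where "R \<ge> 0" "\<And>g. g \<in> fun_span scaled_kernels \<Longrightarrow> nrm (W \<phi> \<sigma> g) \<le> R * nrm g"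
proof -
  note q = adjoint_pair_sym[OF p]
  obtain R1 where R1: "R1 \<ge> 0" "\<And>g. g \<in> scaled_kernels \<Longrightarrow> nrm (W \<phi> \<sigma> g) \<le> R1 * nrm g"
    using weighted_comp_bounded_scaled_kernels[OF p \<gamma>] by blast
  obtain R2 where R2: "R2 \<ge> 0" "\<And>g. g \<in> scaled_kernels \<Longrightarrow> nrm (W \<sigma> \<phi> g) \<le> R2 * nrm g"
    using weighted_comp_bounded_scaled_kernels[OF q \<gamma>] by blast
  have nn: "0 \<le> nrm g" if "g \<in> scaled_kernels" for g
    using that scaled_kernels_subset nrm_nonneg by blast
  show thesis
  proof
    \<comment> \<open>The passage to the span needs one constant for both operators; the sum serves
      for each.\<close>
    show "0 \<le> R1 + R2" using R1(1) R2(1) by simp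
    show "nrm (W \<phi> \<sigma> g) \<le> (R1 + R2) * nrm g" if "g \<in> fun_span scaled_kernels" for g
    proof (rule bounded_on_fun_span[where S = "W \<sigma> \<phi>", OF scaled_kernels_subset
          fun_linear_weighted_comp fun_linear_weighted_comp _ _ _ _ _ _ that])
      show "ip (W \<phi> \<sigma> g) h = ip g (W \<sigma> \<phi> h)" if "g \<in> scaled_kernels" "h \<in> scaled_kernels" for g h
        using weighted_comp_adjoint_scaled_kernels[OF p _ _ that(2)] that(1)
          weighted_comp_scaled_kernels_mem[OF p that(1)] scaled_kernels_subset by blast
      show "nrm (W \<phi> \<sigma> g) \<le> (R1 + R2) * nrm g" if "g \<in> scaled_kernels" for g
        using R1(2)[OF that] mult_nonneg_nonneg[OF R2(1) nn[OF that]] by (simp add: distrib_right)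
      show "nrm (W \<sigma> \<phi> g) \<le> (R1 + R2) * nrm g" if "g \<in> scaled_kernels" for g
        using R2(2)[OF that] mult_nonneg_nonneg[OF R1(1) nn[OF that]] by (simp add: distrib_right)
    qed (use p q R1(1) R2(1) weighted_comp_scaled_kernels_mem in auto)
  qed
qed

section \<open>Extension from the span to the whole space\<close>

lemma pointwise_tendsto:
  assumes "\<And>n. X n \<in> H" "h \<in> H" "(\<lambda>n. nrm (\<lambda>u. X n u - h u)) \<longlonglongrightarrow> 0" "norm z < 1"
  shows "(\<lambda>n. X n z) \<longlonglongrightarrow> h z"
  using ip_tendsto_left[OF assms(1-3) K_mem[OF assms(4)]] assms by (simp add: ip_K)

text \<open>The bound on the span makes the images of an approximating sequence Cauchy. Norm
  convergence implies pointwise convergence, which identifies their limit with the image of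
  \<open>h\<close>.\<close>

lemma weighted_comp_bounded:
  assumes p: "adjoint_pair \<phi> \<sigma>" and \<gamma>: "\<gamma> > 0"
  shows "bounded_operator_on H ip (W \<phi> \<sigma>)"
proof -
  let ?T = "W \<phi> \<sigma>" and ?D = "fun_span scaled_kernels"
  note lin = fun_linear_weighted_comp[of "K (\<sigma> 0)" \<phi>]
  note DH = fun_span_subset[OF scaled_kernels_subset]
  obtain R where R: "R \<ge> 0" "\<And>g. g \<in> ?D \<Longrightarrow> nrm (?T g) \<le> R * nrm g"
    using weighted_comp_bounded_span[OF p \<gamma>] by blast
  have TD: "?T g \<in> ?D" if "g \<in> ?D" for g
    using fun_span_image[OF lin _ that] weighted_comp_scaled_kernels_mem[OF p] fun_span_superset
    by blast
  have "?T h \<in> H \<and> nrm (?T h) \<le> R * nrm h" if h: "h \<in> H" for h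
  proof -
    obtain X where X: "\<And>n::nat. X n \<in> ?D" and lim: "(\<lambda>n. nrm (\<lambda>x. X n x - h x)) \<longlonglongrightarrow> 0"
      using approx_by_kernels[OF h] by blast
    have XH: "X n \<in> H" and TX: "?T (X n) \<in> H" for n using X TD DH by blast+
    have diff: "nrm (\<lambda>x. ?T (X k) x - ?T (X m) x) \<le> R * (nrm (\<lambda>x. X k x - h x) + nrm (\<lambda>x. X m x - h x))"
      for k m
    proof -
      have "nrm (\<lambda>x. ?T (X k) x - ?T (X m) x) \<le> R * nrm (\<lambda>x. X k x - X m x)"
        using R(2)[OF fun_span_diff[OF X X, of k m]] by (simp only: fun_linear_diff[OF lin])
      also have "\<dots> \<le> R * (nrm (\<lambda>x. X k x - h x) + nrm (\<lambda>x. h x - X m x))"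
        using R(1) nrm_triangle_diff[OF XH h XH] by (intro mult_left_mono)
      finally show ?thesis using nrm_minus_commute[OF h XH] by simp
    qed
    have "\<exists>N. \<forall>k\<ge>N. \<forall>m\<ge>N. nrm (\<lambda>x. ?T (X k) x - ?T (X m) x) < e" if e: "e > 0" for e
    proof -
      \<comment> \<open>The bound from \<open>diff\<close> is
        \<open>R * (\<epsilon> + \<epsilon>)\<close>, which is \<open>e\<close> less
        \<open>2 * \<epsilon>\<close>. The summand 1 keeps the definition meaningful for
        \<open>R = 0\<close>.\<close>
      define \<epsilon> where "\<epsilon> = e / (2 * (R + 1))"
      have \<epsilon>: "\<epsilon> > 0" "2 * (R + 1) * \<epsilon> = e" using e R(1) by (simp_all add: \<epsilon>_def)
      obtain N where N: "\<And>n. n \<ge> N \<Longrightarrow> nrm (\<lambda>x. X n x - h x) < \<epsilon>"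
        using order_tendstoD(2)[OF lim \<epsilon>(1)] by (auto simp: eventually_sequentially)
      have "nrm (\<lambda>x. ?T (X k) x - ?T (X m) x) < e" if "k \<ge> N" "m \<ge> N" for k m
      proof -
        have "nrm (\<lambda>x. ?T (X k) x - ?T (X m) x) \<le> R * (\<epsilon> + \<epsilon>)"
          using diff[of k m] mult_left_mono[OF _ R(1), of _ "\<epsilon> + \<epsilon>"] N[OF that(1)] N[OF that(2)]
          by (smt (verit))
        then show ?thesis using \<epsilon> by (simp add: distrib_right)
      qed
      then show ?thesis by blast
    qed
    then obtain g where g: "g \<in> H" and lim': "(\<lambda>n. nrm (\<lambda>x. ?T (X n) x - g x)) \<longlonglongrightarrow> 0"
      using complete[of "\<lambda>n. ?T (X n)"] TX by blast
    have "g z = ?T h z" for z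
    proof (cases "norm z < 1")
      case True
      have "(\<lambda>n. K (\<sigma> 0) z * X n (\<phi> z)) \<longlonglongrightarrow> K (\<sigma> 0) z * h (\<phi> z)"
        by (intro tendsto_intros pointwise_tendsto[OF XH h lim] adjoint_pair_mem(1)[OF p True])
      then have "(\<lambda>n. ?T (X n) z) \<longlonglongrightarrow> ?T h z" using True by (simp add: weighted_comp_def)
      then show ?thesis using pointwise_tendsto[OF TX g lim' True] LIMSEQ_unique by blast
    qed (use vanish_outside[OF g] in \<open>simp add: weighted_comp_def\<close>)
    then have gT: "g = ?T h" by (simp add: fun_eq_iff)
    have "nrm g \<le> R * nrm h"
      using nrm_tendsto[OF TX g lim'] tendsto_mult_left[OF nrm_tendsto[OF XH h lim], of R] R(2)[OF X]
      by (intro LIMSEQ_le) auto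
    then show ?thesis using g gT by simp
  qed
  then show ?thesis
    unfolding bounded_operator_on_def
    using fun_linear_add[OF lin] fun_linear_scale[OF lin] by blast
qed

text \<open>The relation already holds for arbitrary \<open>g\<close> against scaled kernels. Only
  \<open>h\<close> has to be extended: by linearity to the span, then by continuity of the
  operators.\<close>

lemma weighted_comp_adjoint:
  assumes p: "adjoint_pair \<phi> \<sigma>" and \<gamma>: "\<gamma> > 0" and g: "g \<in> H" and h: "h \<in> H"
  shows "ip (W \<phi> \<sigma> g) h = ip g (W \<sigma> \<phi> h)"
proof -
  let ?S = "W \<sigma> \<phi>" and ?D = "fun_span scaled_kernels"
  note lin = fun_linear_weighted_comp[of "K (\<phi> 0)" \<sigma>]
  have Tg: "W \<phi> \<sigma> g \<in> H"
    using weighted_comp_bounded[OF p \<gamma>] g by (auto simp: bounded_operator_on_def)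
  obtain M where SH: "\<And>h. h \<in> H \<Longrightarrow> ?S h \<in> H" and M: "\<And>h. h \<in> H \<Longrightarrow> nrm (?S h) \<le> M * nrm h"
    using weighted_comp_bounded[OF adjoint_pair_sym[OF p] \<gamma>] unfolding bounded_operator_on_def
    by blast
  note DH = fun_span_subset[OF scaled_kernels_subset]
  have adjD: "ip (W \<phi> \<sigma> g) y = ip g (?S y)" if "y \<in> ?D" for y
    using that
  proof induction
    case zero
    show ?case using g Tg by (simp only: fun_linear_zero[OF lin] ip_zero)
  next
    case (step y k c)
    have kH: "k \<in> H" and yH: "y \<in> H" using step scaled_kernels_subset DH by auto
    show ?case
      using step.IH weighted_comp_adjoint_scaled_kernels[OF p g Tg step(2)]
      by (simp only: fun_linear_add[OF lin] fun_linear_scale[OF lin] ip_add_right[OF yH scale_mem[OF kH] Tg]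
          ip_scale_right[OF kH Tg] ip_add_right[OF SH[OF yH] scale_mem[OF SH[OF kH]] g]
          ip_scale_right[OF SH[OF kH] g])
  qed
  obtain X where X: "\<And>n::nat. X n \<in> ?D" and lim: "(\<lambda>n. nrm (\<lambda>x. X n x - h x)) \<longlonglongrightarrow> 0"
    using approx_by_kernels[OF h] by blast
  have XH: "X n \<in> H" for n using X DH by blast
  have "(\<lambda>n. nrm (\<lambda>x. ?S (X n) x - ?S h x)) \<longlonglongrightarrow> 0"
  proof (rule Lim_null_comparison[OF _ tendsto_mult_right_zero[OF lim, of M]],
      rule always_eventually, rule allI)
    fix n
    show "norm (nrm (\<lambda>x. ?S (X n) x - ?S h x)) \<le> M * nrm (\<lambda>x. X n x - h x)"
      using M[OF diff_mem[OF XH h, of n]] nrm_nonneg[OF diff_mem[OF SH[OF XH] SH[OF h], of n]]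
      by (simp only: fun_linear_diff[OF lin] real_norm_def abs_of_nonneg)
  qed
  then have "(\<lambda>n. ip g (?S (X n))) \<longlonglongrightarrow> ip g (?S h)"
    by (rule ip_tendsto_right[OF SH[OF XH] SH[OF h] _ g])
  moreover have "(\<lambda>n. ip (W \<phi> \<sigma> g) (X n)) \<longlonglongrightarrow> ip (W \<phi> \<sigma> g) h"
    by (rule ip_tendsto_right[OF XH h lim Tg])
  ultimately show ?thesis using adjD[OF X] LIMSEQ_unique by simp
qed

section \<open>The two directions of the equivalence\<close>

text \<open>Each product of the two operators is again a weighted composition, with composition maps
  \<open>\<sigma> \<circ> \<phi>\<close> and \<open>\<phi> \<circ> \<sigma>\<close>. As these agree,
  only the weights remain to be compared.\<close>

lemma normal_if_commute:
  assumes p: "adjoint_pair \<phi> \<sigma>" and \<gamma>: "\<gamma> > 0"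
    and n: "norm (\<phi> 0) = norm (\<sigma> 0)" and comm: "\<And>z. norm z < 1 \<Longrightarrow> \<phi> (\<sigma> z) = \<sigma> (\<phi> z)"
  shows "normal_operator_on H ip (W \<phi> \<sigma>)"
proof -
  note q = adjoint_pair_sym[OF p]
  note m = adjoint_pair_mem[OF p]
  \<comment> \<open>Both weights reduce to the same product: the identity is taken at
    \<open>w = \<phi> 0\<close> for the pair and at \<open>w = \<sigma> 0\<close> for the swapped
    pair. Equal norms match the first factors, commutation at 0 the second.\<close>
  have weight: "K (\<sigma> 0) z * K (\<phi> 0) (\<phi> z) = K (\<phi> 0) z * K (\<sigma> 0) (\<sigma> z)" if z: "norm z < 1" for z
  proof (rule ball_kernel_mult_eq)
    have "(1 - herm (\<phi> z) (\<phi> 0)) * (1 - herm z (\<sigma> 0)) = (1 - herm (\<phi> 0) (\<phi> 0)) * (1 - herm z (\<sigma> (\<phi> 0)))"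
      using m z by (intro adjoint_pair_identity[OF p]) auto
    also have "\<dots> = (1 - herm (\<sigma> 0) (\<sigma> 0)) * (1 - herm z (\<phi> (\<sigma> 0)))"
      using comm[of 0] by (simp add: herm_self n)
    also have "\<dots> = (1 - herm (\<sigma> z) (\<sigma> 0)) * (1 - herm z (\<phi> 0))"
      using m z by (intro adjoint_pair_identity[OF q, symmetric]) auto
    finally show "(1 - herm z (\<sigma> 0)) * (1 - herm (\<phi> z) (\<phi> 0)) =
        (1 - herm z (\<phi> 0)) * (1 - herm (\<sigma> z) (\<sigma> 0))"
      by (simp only: mult.commute)
  qed (use m z in auto)
  have "W \<phi> \<sigma> (W \<sigma> \<phi> h) = W \<sigma> \<phi> (W \<phi> \<sigma> h)" for h
  proof
    fix z
    show "W \<phi> \<sigma> (W \<sigma> \<phi> h) z = W \<sigma> \<phi> (W \<phi> \<sigma> h) z"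
    proof (cases "norm z < 1")
      case True
      have "K (\<sigma> 0) z * K (\<phi> 0) (\<phi> z) * h (\<sigma> (\<phi> z)) = K (\<phi> 0) z * K (\<sigma> 0) (\<sigma> z) * h (\<phi> (\<sigma> z))"
        using weight[OF True] comm[OF True] by simp
      then show ?thesis using True m by (simp add: weighted_comp_def mult.assoc)
    qed (simp add: weighted_comp_def)
  qed
  then show ?thesis
    unfolding normal_operator_on_def
    using weighted_comp_bounded[OF p \<gamma>] weighted_comp_bounded[OF q \<gamma>] weighted_comp_adjoint[OF p \<gamma>]
    by blast
qed

text \<open>Normality supplies only some adjoint \<open>S\<close>. The reproducing property forces
  its values on kernels, since \<open>S (K w) z\<close> is the conjugate of the image of
  \<open>K z\<close> evaluated at \<open>w\<close>.\<close>

lemma adjoint_kernel: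
  assumes p: "adjoint_pair \<phi> \<sigma>"
    and T: "\<And>h. h \<in> H \<Longrightarrow> W \<phi> \<sigma> h \<in> H" and S: "\<And>h. h \<in> H \<Longrightarrow> S h \<in> H"
    and adj: "\<And>g h. \<lbrakk>g \<in> H; h \<in> H\<rbrakk> \<Longrightarrow> ip (W \<phi> \<sigma> g) h = ip g (S h)"
    and w: "norm w < 1"
  shows "S (K w) = (\<lambda>z. K w (\<sigma> 0) * K (\<phi> w) z)"
proof (rule eqI_on_ball[OF S scale_mem], rule_tac[1-2] K_mem)
  note m = adjoint_pair_mem[OF p]
  show "norm w < 1" "norm (\<phi> w) < 1" using w m by auto
  fix z :: "complex^'n" assume z: "norm z < 1"
  have "S (K w) z = ip (S (K w)) (K z)" using ip_K[OF z S[OF K_mem[OF w]]] by simp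
  also have "\<dots> = cnj (ip (W \<phi> \<sigma> (K z)) (K w))"
    using adj[OF K_mem[OF z] K_mem[OF w]] ip_sym[OF K_mem[OF z] S[OF K_mem[OF w]]] by simp
  also have "\<dots> = cnj (W \<phi> \<sigma> (K z) w)" using ip_K[OF w T[OF K_mem[OF z]]] by simp
  also have "\<dots> = K w (\<sigma> 0) * K (\<phi> w) z"
    using w z m by (simp add: weighted_comp_def cnj_ball_kernel)
  finally show "S (K w) z = K w (\<sigma> 0) * K (\<phi> w) z" .
qed

text \<open>The two products send \<open>K w\<close> to multiples of
  \<open>K (\<sigma> (\<phi> w))\<close> and \<open>K (\<phi> (\<sigma> w))\<close>. Once the
  scalars are matched, injectivity of the kernel gives commutation.\<close>

lemma commute_if_normal:
  assumes p: "adjoint_pair \<phi> \<sigma>" and \<gamma>: "\<gamma> > 0" and normal: "normal_operator_on H ip (W \<phi> \<sigma>)"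
  shows "norm (\<phi> 0) = norm (\<sigma> 0) \<and> (\<forall>z\<in>ball 0 1. \<phi> (\<sigma> z) = \<sigma> (\<phi> z))"
proof -
  let ?T = "W \<phi> \<sigma>"
  note m = adjoint_pair_mem[OF p]
  obtain S where T: "bounded_operator_on H ip ?T" and Sb: "bounded_operator_on H ip S"
    and adj: "\<And>g h. \<lbrakk>g \<in> H; h \<in> H\<rbrakk> \<Longrightarrow> ip (?T g) h = ip g (S h)"
    and comm: "\<And>h. h \<in> H \<Longrightarrow> ?T (S h) = S (?T h)"
    using normal unfolding normal_operator_on_def by blast
  have TH: "\<And>h. h \<in> H \<Longrightarrow> ?T h \<in> H" and SH: "\<And>h. h \<in> H \<Longrightarrow> S h \<in> H"
    and Sscale: "\<And>c h. h \<in> H \<Longrightarrow> S (\<lambda>x. c * h x) = (\<lambda>x. c * S h x)"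
    using T Sb unfolding bounded_operator_on_def by blast+
  note SK = adjoint_kernel[OF p TH SH adj]
  have eq: "K w (\<sigma> 0) * (K (\<phi> w) (\<phi> 0) * K (\<sigma> (\<phi> w)) z) = K w (\<phi> 0) * (K (\<sigma> w) (\<sigma> 0) * K (\<phi> (\<sigma> w)) z)"
    if w: "norm w < 1" for w z
  proof -
    have "?T (S (K w)) = (\<lambda>z. K w (\<sigma> 0) * (K (\<phi> w) (\<phi> 0) * K (\<sigma> (\<phi> w)) z))"
      using m w by (simp only: SK fun_linear_scale[OF fun_linear_weighted_comp] weighted_comp_kernel[OF p])
    moreover have "S (?T (K w)) = (\<lambda>z. K w (\<phi> 0) * (K (\<sigma> w) (\<sigma> 0) * K (\<phi> (\<sigma> w)) z))"
      using m w by (simp only: SK weighted_comp_kernel[OF p] Sscale K_mem)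
    ultimately show ?thesis using comm[OF K_mem[OF w]] by (metis (no_types))
  qed
  have "\<phi> (\<sigma> w) = \<sigma> (\<phi> w)" if w: "norm w < 1" for w
  proof (rule ball_kernel_inject[OF \<gamma>])
    show "norm (\<phi> (\<sigma> w)) < 1" "norm (\<sigma> (\<phi> w)) < 1" using m w by auto
    fix z :: "complex^'n" assume z: "norm z < 1"
    \<comment> \<open>Every kernel is 1 at the origin, so \<open>z = 0\<close> isolates the scalars;
      they are nonzero and can be cancelled.\<close>
    have c: "K w (\<sigma> 0) * K (\<phi> w) (\<phi> 0) = K w (\<phi> 0) * K (\<sigma> w) (\<sigma> 0)"
      using eq[OF w, of 0] by (simp add: ball_kernel_0)
    have "K w (\<sigma> 0) * K (\<phi> w) (\<phi> 0) \<noteq> 0"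
      using m w by (simp add: ball_kernel_nonzero)
    moreover have "(K w (\<sigma> 0) * K (\<phi> w) (\<phi> 0)) * K (\<sigma> (\<phi> w)) z =
        (K w (\<sigma> 0) * K (\<phi> w) (\<phi> 0)) * K (\<phi> (\<sigma> w)) z"
      using eq[OF w, of z] unfolding mult.assoc[symmetric] c .
    ultimately show "K (\<phi> (\<sigma> w)) z = K (\<sigma> (\<phi> w)) z" by simp
  qed
  moreover have "norm (\<phi> 0) = norm (\<sigma> 0)"
  proof -
    have b: "norm (\<phi> 0) < 1" "norm (\<sigma> 0) < 1" using m by simp_all
    then have b2: "(norm (\<phi> 0))\<^sup>2 < 1" "(norm (\<sigma> 0))\<^sup>2 < 1" by (simp_all add: power_less_one_iff)
    \<comment> \<open>At \<open>w = z = 0\<close> all factors other than these two are 1.\<close>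
    have "K (\<phi> 0) (\<phi> 0) = K (\<sigma> 0) (\<sigma> 0)"
      using eq[of 0 0] b by (simp add: ball_kernel_0)
    then have "(1 - (norm (\<phi> 0))\<^sup>2) powr (- \<gamma>) = (1 - (norm (\<sigma> 0))\<^sup>2) powr (- \<gamma>)"
      using b by (simp only: ball_kernel_self of_real_eq_iff)
    then have "1 - (norm (\<phi> 0))\<^sup>2 = 1 - (norm (\<sigma> 0))\<^sup>2"
      by (rule powr_base_inject) (use b2 \<gamma> in auto)
    then show ?thesis by simp
  qed
  ultimately show ?thesis by simp
qed

end

theorem proposition4p6:
  fixes A :: "complex^'n^'n" and B C :: "complex^'n" and d :: complex and \<gamma> :: real
    and \<phi> \<sigma> :: "complex^'n \<Rightarrow> complex^'n"
    and f :: "complex^'n \<Rightarrow> complex"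
    and H :: "(complex^'n \<Rightarrow> complex) set"
    and ip :: "(complex^'n \<Rightarrow> complex) \<Rightarrow> (complex^'n \<Rightarrow> complex) \<Rightarrow> complex"
  assumes "lin_frac_self_map A B C d"
    and "\<phi> = lin_frac A B C d"
    and "\<sigma> = adjoint_map A B C d"
    and "\<gamma> > 0"
    and "ball_space H ip \<gamma>"
    and "f = ball_kernel \<gamma> (\<sigma> 0)"
  shows "normal_operator_on H ip (weighted_comp f \<phi>) \<longleftrightarrow>
           norm (\<phi> 0) = norm (\<sigma> 0) \<and> (\<forall>z\<in>ball 0 1. \<phi> (\<sigma> z) = \<sigma> (\<phi> z))"
proof -
  have p: "adjoint_pair \<phi> \<sigma>" using lin_frac_adjoint_pair[OF assms(1)] assms(2,3) by simp
  show ?thesis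
    unfolding assms(6)
    using ball_space.commute_if_normal[OF assms(5) p assms(4)]
      ball_space.normal_if_commute[OF assms(5) p assms(4)] by auto
qed

end
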